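(* Let $q\geq3$ and $D\geq 1$ be integers. The standard $\mathcal T(D)$-module $V(D)$ is isomorphic to $$\bigoplus_{p=0}^D\bigoplus_{k=0}^{\lfloor p/2\rfloor}\frac{p-2k+1}{p-k+1}\binom{D}{p}\binom{p}{k}(q-2)^{D-p}\cdot L_{p,k}(D).$$
   Context: Fix an integer $q\geq 3$ and let $X=\{0,1,\dots,q-1\}$. For $D\geq1$, the Hamming graph $H(D,q)$ has vertex set $X^D$, with $x,y$ adjacent iff they differ in exactly one coordinate; $\partial(x,y)$ is the number of coordinates in which $x,y$ differ. $\mathbf A(D)$ is its adjacency matrix and $\mathbf A^*(D)$ the diagonal matrix with $\mathbf A^*(D)_{yy}=D(q-1)-q\,\partial((0,\dots,0),y)$. $\mathcal T(D)$ is the subalgebra of $\mathrm{Mat}_{X^D}(\mathbb C)$ generated by $\mathbf A(D),\mathbf A^*(D)$, and $V(D)=\mathbb C^{X^D}$ (column vectors) is the standard $\mathcal T(D)$-module. For $0\le p\le D$, $0\le k\le\lfloor p/2\rfloor$, set $\alpha_i=(q-2)(i+k)+p-D$, $\beta_i=i+1$, $\gamma_i=(q-1)(p-i-2k+1)$, $\theta_i=q(p-i-k)-D$; $L_{p,k}(D)$ denotes a $(p-2k+1)$-dimensional irreducible $\mathcal T(D)$-module having a basis with respect to which $\mathbf A(D)$ acts by the tridiagonal matrix with diagonal $(\alpha_0,\dots,\alpha_{p-2k})$, entries $(i+1,i)$ equal to $\beta_i$ ($0\le i\le p-2k-1$) and entries $(i-1,i)$ equal to $\gamma_i$ ($1\le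 i\le p-2k$), and $\mathbf A^*(D)$ acts by $\mathrm{diag}(\theta_0,\dots,\theta_{p-2k})$ (such a module exists and is determined up to isomorphism). For a vector space $W$ and positive integer $m$, $m\cdot W$ denotes the direct sum of $m$ copies of $W$. *)

theory Defs
  imports
    Complex_Main
    "HOL-Library.FuncSet"
    "HOL-Algebra.Generated_Rings"
    "HOL-Algebra.Module"
    "Jordan_Normal_Form.VS_Connect"
begin

section \<open>Left modules over a possibly noncommutative ring\<close>

text \<open>
  The locale \<^verbatim>\<open>module\<close> of HOL-Algebra requires a commutative ring of scalars, so its axioms are
  restated here over an arbitrary ring. The fields \<^verbatim>\<open>mult\<close> and \<^verbatim>\<open>one\<close> of a module record carry
  no meaning.
\<close>

locale left_module = R?: ring R + M?: abelian_group M
  for R :: "('a, 'c) ring_scheme" (structure) and M :: "('a, 'b) module" (structure) +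
  assumes smult_closed:
      "\<lbrakk>a \<in> carrier R; x \<in> carrier M\<rbrakk> \<Longrightarrow> a \<odot>\<^bsub>M\<^esub> x \<in> carrier M"
    and smult_l_distr:
      "\<lbrakk>a \<in> carrier R; b \<in> carrier R; x \<in> carrier M\<rbrakk> \<Longrightarrow>
        (a \<oplus>\<^bsub>R\<^esub> b) \<odot>\<^bsub>M\<^esub> x = a \<odot>\<^bsub>M\<^esub> x \<oplus>\<^bsub>M\<^esub> b \<odot>\<^bsub>M\<^esub> x"
    and smult_r_distr:
      "\<lbrakk>a \<in> carrier R; x \<in> carrier M; y \<in> carrier M\<rbrakk> \<Longrightarrow>
        a \<odot>\<^bsub>M\<^esub> (x \<oplus>\<^bsub>M\<^esub> y) = a \<odot>\<^bsub>M\<^esub> x \<oplus>\<^bsub>M\<^esub> a \<odot>\<^bsub>M\<^esub> y"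
    and smult_assoc:
      "\<lbrakk>a \<in> carrier R; b \<in> carrier R; x \<in> carrier M\<rbrakk> \<Longrightarrow>
        (a \<otimes>\<^bsub>R\<^esub> b) \<odot>\<^bsub>M\<^esub> x = a \<odot>\<^bsub>M\<^esub> (b \<odot>\<^bsub>M\<^esub> x)"
    and smult_one: "x \<in> carrier M \<Longrightarrow> \<one>\<^bsub>R\<^esub> \<odot>\<^bsub>M\<^esub> x = x"

definition irreducible_module :: "('a, 'c) ring_scheme \<Rightarrow> ('a, 'b) module \<Rightarrow> bool" where
  "irreducible_module R M \<longleftrightarrow>
     left_module R M \<and> carrier M \<noteq> {\<zero>\<^bsub>M\<^esub>} \<and>
     (\<forall>N. Module.submodule N R M \<longrightarrow> N = {\<zero>\<^bsub>M\<^esub>} \<or> N = carrier M)"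

definition module_isomorphic ::
    "('a, 'c) ring_scheme \<Rightarrow> ('a, 'b) module \<Rightarrow> ('a, 'd) module \<Rightarrow> bool" where
  "module_isomorphic R M N \<longleftrightarrow>
     (\<exists>f \<in> iso (add_monoid M) (add_monoid N).
        \<forall>a \<in> carrier R. \<forall>x \<in> carrier M. f (a \<odot>\<^bsub>M\<^esub> x) = a \<odot>\<^bsub>N\<^esub> f x)"

definition direct_sum_module :: "'i set \<Rightarrow> ('i \<Rightarrow> ('a, 'b) module) \<Rightarrow> ('a, 'i \<Rightarrow> 'b) module" where
  "direct_sum_module I M =
     \<lparr>carrier = {f \<in> (\<Pi>\<^sub>E i\<in>I. carrier (M i)). finite {i \<in> I. f i \<noteq> \<zero>\<^bsub>M i\<^esub>}},
      mult = undefined, one = undefined,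
      zero = (\<lambda>i\<in>I. \<zero>\<^bsub>M i\<^esub>),
      add = (\<lambda>f g. \<lambda>i\<in>I. f i \<oplus>\<^bsub>M i\<^esub> g i),
      smult = (\<lambda>a f. \<lambda>i\<in>I. a \<odot>\<^bsub>M i\<^esub> f i)\<rparr>"

definition copies :: "nat \<Rightarrow> ('a, 'b) module \<Rightarrow> ('a, nat \<Rightarrow> 'b) module" where
  "copies m M = direct_sum_module {..<m} (\<lambda>_. M)"

lemma left_module_direct_sum_module:
  assumes R: "ring R" and M: "\<And>i. i \<in> I \<Longrightarrow> left_module R (M i)"
  shows "left_module R (direct_sum_module I M)"
proof -
  have ab: "abelian_group (M i)" if "i \<in> I" for i
    using M[OF that] by (simp add: left_module_def)
  have sz: "a \<odot>\<^bsub>M i\<^esub> \<zero>\<^bsub>M i\<^esub> = \<zero>\<^bsub>M i\<^esub>" if "i \<in> I" "a \<in> carrier R" for i a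
  proof -
    interpret left_module R "M i" by (rule M[OF that(1)])
    have "a \<odot>\<^bsub>M i\<^esub> \<zero>\<^bsub>M i\<^esub> \<oplus>\<^bsub>M i\<^esub> a \<odot>\<^bsub>M i\<^esub> \<zero>\<^bsub>M i\<^esub> = a \<odot>\<^bsub>M i\<^esub> \<zero>\<^bsub>M i\<^esub>"
      using smult_r_distr[OF that(2), of "\<zero>\<^bsub>M i\<^esub>" "\<zero>\<^bsub>M i\<^esub>"] by simp
    then show ?thesis
      using smult_closed[OF that(2), of "\<zero>\<^bsub>M i\<^esub>"] by (simp add: M.add.l_cancel_one)
  qed
  note AG = abelian_groupE[OF ab]
  have fin_add: "finite {i \<in> I. f i \<oplus>\<^bsub>M i\<^esub> g i \<noteq> \<zero>\<^bsub>M i\<^esub>}"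
    if "finite {i \<in> I. f i \<noteq> \<zero>\<^bsub>M i\<^esub>}" "finite {i \<in> I. g i \<noteq> \<zero>\<^bsub>M i\<^esub>}" for f g
    by (rule finite_subset[OF _ finite_UnI[OF that]]) (auto simp: AG)
  have fin_smult: "finite {i \<in> I. a \<odot>\<^bsub>M i\<^esub> f i \<noteq> \<zero>\<^bsub>M i\<^esub>}"
    if "finite {i \<in> I. f i \<noteq> \<zero>\<^bsub>M i\<^esub>}" "a \<in> carrier R" for a f
    by (rule finite_subset[OF _ that(1)]) (auto simp: sz that(2))
  have "abelian_group (direct_sum_module I M)"
  proof (rule abelian_groupI)
    fix f assume f: "f \<in> carrier (direct_sum_module I M)"
    let ?g = "\<lambda>i\<in>I. \<ominus>\<^bsub>M i\<^esub> f i"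
    have fi: "f i \<in> carrier (M i)" if "i \<in> I" for i
      using f that by (auto simp: direct_sum_module_def)
    have neg: "\<ominus>\<^bsub>M i\<^esub> \<zero>\<^bsub>M i\<^esub> = \<zero>\<^bsub>M i\<^esub>" if "i \<in> I" for i
      using ab[OF that] by (simp add: abelian_group.minus_equality abelian_groupE)
    have "finite {i \<in> I. \<ominus>\<^bsub>M i\<^esub> f i \<noteq> \<zero>\<^bsub>M i\<^esub>}"
      by (rule finite_subset[of _ "{i \<in> I. f i \<noteq> \<zero>\<^bsub>M i\<^esub>}"])
        (use f neg in \<open>auto simp: direct_sum_module_def\<close>)
    then have "finite {i \<in> I. ?g i \<noteq> \<zero>\<^bsub>M i\<^esub>}"
      by (rule rev_finite_subset) auto
    then have "?g \<in> carrier (direct_sum_module I M)"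
      using fi ab by (auto simp: direct_sum_module_def abelian_group.a_inv_closed)
    moreover have "?g \<oplus>\<^bsub>direct_sum_module I M\<^esub> f = \<zero>\<^bsub>direct_sum_module I M\<^esub>"
      using fi ab by (auto simp: direct_sum_module_def abelian_group.l_neg intro!: restrict_ext)
    ultimately show "\<exists>y\<in>carrier (direct_sum_module I M).
        y \<oplus>\<^bsub>direct_sum_module I M\<^esub> f = \<zero>\<^bsub>direct_sum_module I M\<^esub>" by blast
  next
    fix f g assume "f \<in> carrier (direct_sum_module I M)" "g \<in> carrier (direct_sum_module I M)"
    then show "f \<oplus>\<^bsub>direct_sum_module I M\<^esub> g \<in> carrier (direct_sum_module I M)"
      using fin_add[of f g]
      by (auto simp: direct_sum_module_def dest: PiE_mem intro!: AG(1) cong: conj_cong)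
  next
    fix f g h
    assume "f \<in> carrier (direct_sum_module I M)" "g \<in> carrier (direct_sum_module I M)"
      "h \<in> carrier (direct_sum_module I M)"
    then show "f \<oplus>\<^bsub>direct_sum_module I M\<^esub> g \<oplus>\<^bsub>direct_sum_module I M\<^esub> h =
        f \<oplus>\<^bsub>direct_sum_module I M\<^esub> (g \<oplus>\<^bsub>direct_sum_module I M\<^esub> h)"
      by (auto simp: direct_sum_module_def AG(3) PiE_iff intro!: restrict_ext)
  next
    fix f g
    assume "f \<in> carrier (direct_sum_module I M)" "g \<in> carrier (direct_sum_module I M)"
    then show "f \<oplus>\<^bsub>direct_sum_module I M\<^esub> g = g \<oplus>\<^bsub>direct_sum_module I M\<^esub> f"
      by (auto simp: direct_sum_module_def PiE_iff intro!: restrict_ext AG(4))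
  next
    fix f assume "f \<in> carrier (direct_sum_module I M)"
    then show "\<zero>\<^bsub>direct_sum_module I M\<^esub> \<oplus>\<^bsub>direct_sum_module I M\<^esub> f = f"
      by (intro ext) (auto simp: direct_sum_module_def PiE_iff AG(5) extensional_def)
  qed (auto simp: direct_sum_module_def AG(2) cong: conj_cong)
  moreover have "a \<odot>\<^bsub>direct_sum_module I M\<^esub> f \<in> carrier (direct_sum_module I M)"
    if "a \<in> carrier R" "f \<in> carrier (direct_sum_module I M)" for a f
    using that fin_smult[of f a] M
    by (auto simp: direct_sum_module_def dest: PiE_mem intro!: left_module.smult_closed
        cong: conj_cong)
  moreover have "\<one>\<^bsub>R\<^esub> \<odot>\<^bsub>direct_sum_module I M\<^esub> f = f" if "f \<in> carrier (direct_sum_module I M)" for f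
    using that
    by (intro ext)
      (auto simp: direct_sum_module_def PiE_iff left_module.smult_one[OF M] extensional_def)
  moreover have "a \<odot>\<^bsub>direct_sum_module I M\<^esub> (f \<oplus>\<^bsub>direct_sum_module I M\<^esub> g) =
      a \<odot>\<^bsub>direct_sum_module I M\<^esub> f \<oplus>\<^bsub>direct_sum_module I M\<^esub> a \<odot>\<^bsub>direct_sum_module I M\<^esub> g"
    if "a \<in> carrier R" "f \<in> carrier (direct_sum_module I M)" "g \<in> carrier (direct_sum_module I M)"
    for a f g
    using that
    by (auto simp: direct_sum_module_def PiE_iff left_module.smult_r_distr[OF M]
        intro!: restrict_ext)
  moreover have "(a \<oplus>\<^bsub>R\<^esub> b) \<odot>\<^bsub>direct_sum_module I M\<^esub> f =
      a \<odot>\<^bsub>direct_sum_module I M\<^esub> f \<oplus>\<^bsub>direct_sum_module I M\<^esub> b \<odot>\<^bsub>direct_sum_module I M\<^esub> f"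
    "(a \<otimes>\<^bsub>R\<^esub> b) \<odot>\<^bsub>direct_sum_module I M\<^esub> f =
      a \<odot>\<^bsub>direct_sum_module I M\<^esub> (b \<odot>\<^bsub>direct_sum_module I M\<^esub> f)"
    if "a \<in> carrier R" "b \<in> carrier R" "f \<in> carrier (direct_sum_module I M)" for a b f
    using that
    by (auto simp: direct_sum_module_def PiE_iff left_module.smult_l_distr[OF M]
        left_module.smult_assoc[OF M] intro!: restrict_ext)
  ultimately show ?thesis
    using R by (intro left_module.intro left_module_axioms.intro)
qed


section \<open>Complex matrices indexed by a finite set\<close>

text \<open>
  A matrix indexed by \<^verbatim>\<open>I\<close> is a function of two arguments vanishing outside \<open>I \<times> I\<close>; a column vector
  is a function of one argument vanishing outside \<^verbatim>\<open>I\<close>.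
\<close>

type_synonym 'i sqmat = "'i \<Rightarrow> 'i \<Rightarrow> complex"

definition Mat :: "'i set \<Rightarrow> (complex, 'i sqmat) module" where
  "Mat I =
     \<lparr>carrier = {A. \<forall>x y. x \<notin> I \<or> y \<notin> I \<longrightarrow> A x y = 0},
      mult = (\<lambda>A B x y. \<Sum>z\<in>I. A x z * B z y),
      one = (\<lambda>x y. if x \<in> I \<and> x = y then 1 else 0),
      zero = (\<lambda>x y. 0),
      add = (\<lambda>A B x y. A x y + B x y),
      smult = (\<lambda>c A x y. c * A x y)\<rparr>"

definition column_space :: "'i set \<Rightarrow> ('i sqmat, 'i \<Rightarrow> complex) module" where
  "column_space I =
     \<lparr>carrier = {v. \<forall>x. x \<notin> I \<longrightarrow> v x = 0},
      mult = undefined, one = undefined,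
      zero = (\<lambda>x. 0),
      add = (\<lambda>v w x. v x + w x),
      smult = (\<lambda>A v x. \<Sum>y\<in>I. A x y * v y)\<rparr>"

text \<open>The unital subalgebra generated by \<^verbatim>\<open>H\<close>.\<close>

definition generated_subalgebra :: "(complex, 'b) module \<Rightarrow> 'b set \<Rightarrow> (complex, 'b) module" where
  "generated_subalgebra A H =
     A\<lparr>carrier := generate_ring A (H \<union> range (\<lambda>c. c \<odot>\<^bsub>A\<^esub> \<one>\<^bsub>A\<^esub>))\<rparr>"

text \<open>
  The complex vector space underlying a left module \<^verbatim>\<open>M\<close> over a unital complex algebra \<^verbatim>\<open>A\<close>: the
  scalar \<^verbatim>\<open>c\<close> acts as \<open>c \<cdot> 1\<close>.
\<close>

definition complex_space :: "(complex, 'a) module \<Rightarrow> ('a, 'b) module \<Rightarrow> (complex, 'b) module" where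
  "complex_space A M =
     \<lparr>carrier = carrier M, mult = mult M, one = one M, zero = zero M, add = add M,
      smult = (\<lambda>c v. (c \<odot>\<^bsub>A\<^esub> \<one>\<^bsub>A\<^esub>) \<odot>\<^bsub>M\<^esub> v)\<rparr>"

definition ordered_basis :: "(complex, 'b) module \<Rightarrow> nat \<Rightarrow> (nat \<Rightarrow> 'b) \<Rightarrow> bool" where
  "ordered_basis W n v \<longleftrightarrow>
     inj_on v {..<n} \<and> vectorspace.basis class_ring W (v ` {..<n})"

text \<open>With respect to \<^verbatim>\<open>v\<close>, the element \<^verbatim>\<open>a\<close> acts by the \<open>n \<times> n\<close> matrix \<^verbatim>\<open>B\<close>, whose columns hold the
  coordinates of the images of the basis vectors.\<close>

definition acts_by ::
    "(complex, 'a) module \<Rightarrow> ('a, 'b) module \<Rightarrow> nat \<Rightarrow> (nat \<Rightarrow> 'b) \<Rightarrow> 'a \<Rightarrow> nat sqmat \<Rightarrow> bool" where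
  "acts_by A M n v a B \<longleftrightarrow>
     (\<forall>j<n. a \<odot>\<^bsub>M\<^esub> v j = (\<Oplus>\<^bsub>M\<^esub> i \<in> {..<n}. B i j \<odot>\<^bsub>complex_space A M\<^esub> v i))"

lemma ring_Mat:
  assumes "finite I"
  shows "ring (Mat I)"
proof (intro ringI abelian_groupI monoidI)
  fix A B C
  assume "A \<in> carrier (Mat I)" "B \<in> carrier (Mat I)" "C \<in> carrier (Mat I)"
  show "A \<otimes>\<^bsub>Mat I\<^esub> B \<otimes>\<^bsub>Mat I\<^esub> C = A \<otimes>\<^bsub>Mat I\<^esub> (B \<otimes>\<^bsub>Mat I\<^esub> C)"
    by (intro ext) (simp add: Mat_def sum_distrib_left sum_distrib_right mult.assoc, rule sum.swap)
next
  fix A assume A: "A \<in> carrier (Mat I)"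
  show "\<one>\<^bsub>Mat I\<^esub> \<otimes>\<^bsub>Mat I\<^esub> A = A"
  proof (intro ext)
    fix x y
    show "(\<one>\<^bsub>Mat I\<^esub> \<otimes>\<^bsub>Mat I\<^esub> A) x y = A x y"
    proof (cases "x \<in> I")
      case True
      then have "(\<one>\<^bsub>Mat I\<^esub> \<otimes>\<^bsub>Mat I\<^esub> A) x y = (\<Sum>z\<in>I. if x = z then A z y else 0)"
        by (auto simp: Mat_def intro!: sum.cong)
      with True assms show ?thesis by simp
    qed (use A in \<open>auto simp: Mat_def\<close>)
  qed
  show "A \<otimes>\<^bsub>Mat I\<^esub> \<one>\<^bsub>Mat I\<^esub> = A"
  proof (intro ext)
    fix x y
    show "(A \<otimes>\<^bsub>Mat I\<^esub> \<one>\<^bsub>Mat I\<^esub>) x y = A x y"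
    proof (cases "y \<in> I")
      case True
      then have "(A \<otimes>\<^bsub>Mat I\<^esub> \<one>\<^bsub>Mat I\<^esub>) x y = (\<Sum>z\<in>I. if z = y then A x z else 0)"
        by (auto simp: Mat_def intro!: sum.cong)
      with True assms show ?thesis by simp
    next
      case False
      with A show ?thesis by (auto simp: Mat_def intro!: sum.neutral)
    qed
  qed
  show "\<exists>B\<in>carrier (Mat I). B \<oplus>\<^bsub>Mat I\<^esub> A = \<zero>\<^bsub>Mat I\<^esub>"
    using A by (intro bexI[of _ "\<lambda>x y. - A x y"]) (auto simp: Mat_def)
qed (auto simp: Mat_def algebra_simps sum.distrib intro!: sum.neutral)

lemma left_module_column_space:
  assumes "finite I"
  shows "left_module (Mat I) (column_space I)"
proof -
  have "abelian_group (column_space I)"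
  proof (rule abelian_groupI)
    fix v assume "v \<in> carrier (column_space I)"
    then show "\<exists>w\<in>carrier (column_space I). w \<oplus>\<^bsub>column_space I\<^esub> v = \<zero>\<^bsub>column_space I\<^esub>"
      by (intro bexI[of _ "\<lambda>x. - v x"]) (auto simp: column_space_def)
  qed (auto simp: column_space_def algebra_simps)
  moreover have "\<one>\<^bsub>Mat I\<^esub> \<odot>\<^bsub>column_space I\<^esub> v = v" if v: "v \<in> carrier (column_space I)" for v
  proof
    fix x
    show "(\<one>\<^bsub>Mat I\<^esub> \<odot>\<^bsub>column_space I\<^esub> v) x = v x"
    proof (cases "x \<in> I")
      case True
      then have "(\<one>\<^bsub>Mat I\<^esub> \<odot>\<^bsub>column_space I\<^esub> v) x = (\<Sum>z\<in>I. if x = z then v z else 0)"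
        by (auto simp: Mat_def column_space_def intro!: sum.cong)
      with True assms show ?thesis by simp
    qed (use v in \<open>auto simp: Mat_def column_space_def\<close>)
  qed
  moreover have "(A \<otimes>\<^bsub>Mat I\<^esub> B) \<odot>\<^bsub>column_space I\<^esub> v = A \<odot>\<^bsub>column_space I\<^esub> (B \<odot>\<^bsub>column_space I\<^esub> v)"
    for A B v
    by (intro ext)
      (simp add: Mat_def column_space_def sum_distrib_left sum_distrib_right mult.assoc, rule sum.swap)
  ultimately show ?thesis
    unfolding left_module_def left_module_axioms_def
    using ring_Mat[OF assms]
    by (auto simp: Mat_def column_space_def algebra_simps sum.distrib)
qed


section \<open>The Terwilliger algebra of the Hamming graph\<close>

definition vertices :: "nat \<Rightarrow> nat \<Rightarrow> nat list set" where
  "vertices q D = {x. length x = D \<and> set x \<subseteq> {0..<q}}"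

definition hamming_dist :: "nat list \<Rightarrow> nat list \<Rightarrow> nat" where
  "hamming_dist x y = card {i. i < length x \<and> x ! i \<noteq> y ! i}"

definition adjacent :: "nat \<Rightarrow> nat \<Rightarrow> nat list \<Rightarrow> nat list \<Rightarrow> bool" where
  "adjacent q D x y \<longleftrightarrow> x \<in> vertices q D \<and> y \<in> vertices q D \<and> hamming_dist x y = 1"

definition adjacency_matrix :: "nat \<Rightarrow> nat \<Rightarrow> nat list sqmat" where
  "adjacency_matrix q D = (\<lambda>x y. if adjacent q D x y then 1 else 0)"

definition dual_adjacency_matrix :: "nat \<Rightarrow> nat \<Rightarrow> nat list sqmat" where
  "dual_adjacency_matrix q D = (\<lambda>x y. if x \<in> vertices q D \<and> x = y
     then of_nat D * (of_nat q - 1) - of_nat q * of_nat (hamming_dist (replicate D 0) y)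
     else 0)"

definition terwilliger :: "nat \<Rightarrow> nat \<Rightarrow> (complex, nat list sqmat) module" where
  "terwilliger q D =
     generated_subalgebra (Mat (vertices q D)) {adjacency_matrix q D, dual_adjacency_matrix q D}"

definition standard_module :: "nat \<Rightarrow> nat \<Rightarrow> (nat list sqmat, nat list \<Rightarrow> complex) module" where
  "standard_module q D = column_space (vertices q D)"

lemma finite_vertices: "finite (vertices q D)"
  using finite_lists_length_eq[of "{0..<q}" D] by (simp add: vertices_def conj_commute)

lemma terwilliger_generators:
  "{adjacency_matrix q D, dual_adjacency_matrix q D} \<union>
     range (\<lambda>c. c \<odot>\<^bsub>Mat (vertices q D)\<^esub> \<one>\<^bsub>Mat (vertices q D)\<^esub>) \<subseteq> carrier (Mat (vertices q D))"
  by (auto simp: Mat_def adjacency_matrix_def dual_adjacency_matrix_def adjacent_def)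

lemma ring_terwilliger: "ring (terwilliger q D)"
  unfolding terwilliger_def generated_subalgebra_def
  by (rule ring.generate_ring_is_ring[OF ring_Mat[OF finite_vertices] terwilliger_generators])

lemma left_module_standard: "left_module (terwilliger q D) (standard_module q D)"
proof -
  interpret left_module "Mat (vertices q D)" "column_space (vertices q D)"
    by (rule left_module_column_space[OF finite_vertices])
  have "carrier (terwilliger q D) \<subseteq> carrier (Mat (vertices q D))"
    using ring.generate_ring_incl[OF ring_Mat[OF finite_vertices] terwilliger_generators]
    by (simp add: terwilliger_def generated_subalgebra_def)
  moreover have "add (terwilliger q D) = add (Mat (vertices q D))"
    "mult (terwilliger q D) = mult (Mat (vertices q D))"
    "one (terwilliger q D) = one (Mat (vertices q D))"
    by (simp_all add: terwilliger_def generated_subalgebra_def)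
  ultimately show ?thesis
    unfolding standard_module_def left_module_def left_module_axioms_def
    using ring_terwilliger M.abelian_group_axioms smult_closed smult_l_distr smult_r_distr
      smult_assoc smult_one
    by (auto simp: subset_iff)
qed

lemma vectorspace_complex_space:
  assumes "left_module (terwilliger q D) M"
  shows "vectorspace class_ring (complex_space (terwilliger q D) M)"
proof -
  let ?T = "terwilliger q D" and ?c = "\<lambda>c. c \<odot>\<^bsub>terwilliger q D\<^esub> \<one>\<^bsub>terwilliger q D\<^esub>"
  interpret left_module ?T M by fact
  have c: "?c a \<in> carrier ?T" for a
    by (auto simp: terwilliger_def generated_subalgebra_def intro: generate_ring.incl)
  have add: "?c (a + b) = ?c a \<oplus>\<^bsub>?T\<^esub> ?c b" and one: "?c 1 = \<one>\<^bsub>?T\<^esub>" for a b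
    by (auto simp: terwilliger_def generated_subalgebra_def Mat_def algebra_simps)
  have mult: "?c (a * b) = ?c a \<otimes>\<^bsub>?T\<^esub> ?c b" for a b
  proof (intro ext)
    fix x y
    have "(\<Sum>z\<in>vertices q D. (a * (if x \<in> vertices q D \<and> x = z then 1 else 0)) *
        (b * (if z \<in> vertices q D \<and> z = y then 1 else 0))) =
      (\<Sum>z\<in>vertices q D. if x = z then (if x = y then a * b else 0) else 0)"
      by (rule sum.cong) auto
    then show "?c (a * b) x y = (?c a \<otimes>\<^bsub>?T\<^esub> ?c b) x y"
      using finite_vertices[of q D] by (simp add: terwilliger_def generated_subalgebra_def Mat_def)
  qed
  have "abelian_group (complex_space ?T M)"
    by (rule abelian_groupI)
      (use M.l_neg M.a_inv_closed in
        \<open>auto simp: complex_space_def M.a_assoc intro: M.a_comm\<close>)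
  then have "Module.module class_ring (complex_space ?T M)"
    by (intro moduleI)
      (auto simp: complex_space_def class_ring_simps class_cring.cring_axioms c add mult one
        smult_closed smult_l_distr smult_r_distr smult_assoc smult_one)
  then show ?thesis by (simp add: vectorspace_def class_field.field_axioms)
qed


section \<open>The irreducible modules and their multiplicities\<close>

definition alpha :: "nat \<Rightarrow> nat \<Rightarrow> nat \<Rightarrow> nat \<Rightarrow> nat \<Rightarrow> complex" where
  "alpha q D p k i = (of_nat q - 2) * (of_nat i + of_nat k) + of_nat p - of_nat D"

definition beta :: "nat \<Rightarrow> complex" where
  "beta i = of_nat i + 1"

definition gamma :: "nat \<Rightarrow> nat \<Rightarrow> nat \<Rightarrow> nat \<Rightarrow> complex" where
  "gamma q p k i = (of_nat q - 1) * (of_nat p - of_nat i - 2 * of_nat k + 1)"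

definition theta :: "nat \<Rightarrow> nat \<Rightarrow> nat \<Rightarrow> nat \<Rightarrow> nat \<Rightarrow> complex" where
  "theta q D p k i = of_nat q * (of_nat p - of_nat i - of_nat k) - of_nat D"

definition tridiag_L :: "nat \<Rightarrow> nat \<Rightarrow> nat \<Rightarrow> nat \<Rightarrow> nat sqmat" where
  "tridiag_L q D p k r s =
     (if r = s then alpha q D p k s
      else if r = s + 1 then beta s
      else if s = r + 1 then gamma q p k s
      else 0)"

definition diag_L :: "nat \<Rightarrow> nat \<Rightarrow> nat \<Rightarrow> nat \<Rightarrow> nat sqmat" where
  "diag_L q D p k r s = (if r = s then theta q D p k s else 0)"

text \<open>\<open>M\<close> is a module denoted by \<open>L\<^sub>p\<^sub>,\<^sub>k(D)\<close>.\<close>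

definition is_L :: "nat \<Rightarrow> nat \<Rightarrow> nat \<Rightarrow> nat \<Rightarrow> (nat list sqmat, 'b) module \<Rightarrow> bool" where
  "is_L q D p k M \<longleftrightarrow>
     irreducible_module (terwilliger q D) M \<and>
     vectorspace.dim class_ring (complex_space (terwilliger q D) M) = p - 2 * k + 1 \<and>
     (\<exists>v. ordered_basis (complex_space (terwilliger q D) M) (p - 2 * k + 1) v \<and>
          acts_by (terwilliger q D) M (p - 2 * k + 1) v (adjacency_matrix q D) (tridiag_L q D p k) \<and>
          acts_by (terwilliger q D) M (p - 2 * k + 1) v (dual_adjacency_matrix q D) (diag_L q D p k))"

text \<open>The division is exact, see the lemma below.\<close>

definition multiplicity_L :: "nat \<Rightarrow> nat \<Rightarrow> nat \<Rightarrow> nat \<Rightarrow> nat" where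
  "multiplicity_L q D p k =
     ((p - 2 * k + 1) * (D choose p) * (p choose k) * (q - 2) ^ (D - p)) div (p - k + 1)"

lemma multiplicity_L_eq:
  assumes "2 \<le> q" "p \<le> D" "k \<le> p div 2"
  shows "real (multiplicity_L q D p k) =
    (real p - 2 * real k + 1) / (real p - real k + 1) *
    real (D choose p) * real (p choose k) * (real q - 2) ^ (D - p)"
proof -
  have kp: "2 * k \<le> p" using assms(3) by linarith
  have "(p - k + 1) dvd (p - 2 * k + 1) * (p choose k)"
  proof (cases k)
    case (Suc j)
    have "Suc j * (p choose Suc j) = (p - j) * (p choose j)"
      using binomial_absorb_comp[of p j] times_binomial_minus1_eq[of "Suc j" p]
      by (metis diff_Suc_1 zero_less_Suc)
    moreover from kp Suc have "p - 2 * k + 1 + Suc j = p - j" "p - k + 1 = p - j" by linarith+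
    ultimately have "(p - 2 * k + 1) * (p choose k) + (p - k + 1) * (p choose j) =
        (p - k + 1) * (p choose k)"
      using Suc by (metis add_mult_distrib)
    then show ?thesis by (metis dvd_add_left_iff dvd_triv_left)
  qed simp
  then have "(p - k + 1) dvd (p - 2 * k + 1) * (D choose p) * (p choose k) * (q - 2) ^ (D - p)"
    by (metis dvd_mult2 mult.assoc mult.commute)
  then have "real (multiplicity_L q D p k) =
      real ((p - 2 * k + 1) * (D choose p) * (p choose k) * (q - 2) ^ (D - p)) / real (p - k + 1)"
    unfolding multiplicity_L_def by (rule real_of_nat_div)
  moreover have "real (p - 2 * k + 1) = real p - 2 * real k + 1"
    "real (p - k + 1) = real p - real k + 1" "real (q - 2) = real q - 2"
    using kp assms(1) by auto
  ultimately show ?thesis by (simp only: of_nat_mult of_nat_power times_divide_eq_left)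
qed

end

theory Submission
  imports Defs "HOL-Library.Function_Algebras"
begin

text \<open>
  Splitting off one coordinate, \<open>V(D + 1) = V(1) \<otimes> V(D)\<close>, and both generators act on the tensor product
  by \<open>A \<otimes> 1 + 1 \<otimes> A\<close>. Since \<open>V(1)\<close> is the sum of \<open>L\<^sub>1\<^sub>,\<^sub>0(1)\<close> and of \<open>q - 2\<close> copies of \<open>L\<^sub>0\<^sub>,\<^sub>0(1)\<close>, a copy of
  \<open>L\<^sub>p\<^sub>,\<^sub>k(D)\<close> contributes \<open>q - 2\<close> copies of \<open>L\<^sub>p\<^sub>,\<^sub>k(D + 1)\<close> and, by explicit Clebsch--Gordan formulas, one
  copy of \<open>L\<^sub>p\<^sub>+\<^sub>1\<^sub>,\<^sub>k(D + 1)\<close> and, if \<open>2 k < p\<close>, one copy of \<open>L\<^sub>p\<^sub>+\<^sub>1\<^sub>,\<^sub>k\<^sub>+\<^sub>1(D + 1)\<close>. The resulting recurrence for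
  the multiplicities is solved by the ballot numbers times \<open>(D choose p) (q - 2)\<^bsup>D - p\<^esup>\<close>. The basis
  vectors obtained in this way span \<open>V(D)\<close> and there are \<open>q\<^sup>D\<close> of them, so they form a basis, and the
  coordinates with respect to it define the isomorphism.
\<close>

text \<open>The Clebsch--Gordan formulas come from symmetric powers. Let x = \<open>unit0\<close>
  and y = \<open>ones\<close>, the basis of \<open>L_{1,0}(1)\<close>, and let n = p - 2k. Let both
  generators act as derivations on the n-th symmetric power of \<open>L_{1,0}(1)\<close>. Then the
  vectors \<open>binom(n, i) x^(n-i) y^i\<close> satisfy the relations of \<open>L_{p,k}(D)\<close>,
  up to adding the scalar \<open>(q - 2) k + p - D\<close> to both generators; the factor
  \<open>binom(n, i)\<close> is what makes the lower entries \<open>i + 1\<close>. Polarization,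
  \<open>x \<otimes> d/dx + y \<otimes> d/dy\<close> up to a factor, yields
  \<open>string_top\<close>, and multiplication by \<open>y \<otimes> x - x \<otimes> y\<close>
  yields \<open>string_bot\<close>. On the latter tensor both generators act by
  \<open>q - 2\<close>, which is the shift caused by raising k.

  The modules L are arbitrary, known only through a basis in which the generators have prescribed
  matrices. The isomorphism therefore matches coordinates, and agreement on the two generators
  extends to the algebra they generate. The existence half takes the span of a single string in V(D)
  as its model.\<close>

lemma sum_fun_apply: "(\<Sum>i\<in>I. f i) x = (\<Sum>i\<in>I. f i x)"
  for f :: "'i \<Rightarrow> 'a \<Rightarrow> 'b::comm_monoid_add"
  by (induction I rule: infinite_finite_induct) auto

section \<open>Strings in the standard module\<close>

abbreviation mat_vec :: "nat \<Rightarrow> nat \<Rightarrow> nat list sqmat \<Rightarrow> (nat list \<Rightarrow> complex) \<Rightarrow> nat list \<Rightarrow> complex" where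
  "mat_vec q D A v \<equiv> A \<odot>\<^bsub>standard_module q D\<^esub> v"

lemma mat_vec_apply: "mat_vec q D A v x = (\<Sum>y\<in>vertices q D. A x y * v y)"
  by (simp add: standard_module_def column_space_def)

section \<open>Splitting off the first coordinate\<close>

definition tens :: "(nat \<Rightarrow> complex) \<Rightarrow> (nat list \<Rightarrow> complex) \<Rightarrow> nat list \<Rightarrow> complex" where
  "tens u v x = (case x of [] \<Rightarrow> 0 | a # y \<Rightarrow> u a * v y)"

lemma tens_simps [simp]: "tens u v [] = 0" "tens u v (a # y) = u a * v y"
  by (simp_all add: tens_def)

lemma vertices_0: "vertices q 0 = {[]}"
  by (auto simp: vertices_def)

lemma Cons_in_vertices [simp]: "a # x \<in> vertices q (Suc D) \<longleftrightarrow> a < q \<and> x \<in> vertices q D"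
  by (auto simp: vertices_def)

lemma Nil_notin_vertices [simp]: "[] \<notin> vertices q (Suc D)"
  by (simp add: vertices_def)

lemma vertices_Suc: "vertices q (Suc D) = (\<lambda>(a, x). a # x) ` ({..<q} \<times> vertices q D)"
  by (auto simp: vertices_def length_Suc_conv image_iff)

lemma sum_vertices_Suc:
  "(\<Sum>x\<in>vertices q (Suc D). f x) = (\<Sum>a<q. \<Sum>x\<in>vertices q D. f (a # x))"
  unfolding vertices_Suc
  by (subst sum.reindex) (auto simp: inj_on_def sum.cartesian_product intro: sum.cong)

lemma hamming_dist_Cons:
  "hamming_dist (a # x) (b # y) = (if a = b then 0 else 1) + hamming_dist x y"
proof -
  have "{i. i < length (a # x) \<and> (a # x) ! i \<noteq> (b # y) ! i} =
      (if a = b then {} else {0}) \<union> Suc ` {i. i < length x \<and> x ! i \<noteq> y ! i}"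
    by (auto simp: image_iff less_Suc_eq_0_disj)
  then show ?thesis
    by (simp add: hamming_dist_def card_image)
qed

lemma hamming_dist_eq_0_iff:
  assumes "length x = length y"
  shows "hamming_dist x y = 0 \<longleftrightarrow> x = y"
  using assms by (auto simp: hamming_dist_def list_eq_iff_nth_eq)

text \<open>H(D + 1, q) is the Cartesian product of the complete graph on q letters with H(D, q): a
  single difference lies either in the head or in the tail.\<close>

lemma adjacency_matrix_Cons:
  assumes "x \<in> vertices q D" "y \<in> vertices q D" "a < q" "b < q"
  shows "adjacency_matrix q (Suc D) (a # x) (b # y) =
    (if a = b then adjacency_matrix q D x y else if x = y then 1 else 0)"
  using assms hamming_dist_eq_0_iff[of x y]
  by (auto simp: adjacency_matrix_def adjacent_def hamming_dist_Cons vertices_def)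

lemma adjacency_matrix_outside:
  "x \<notin> vertices q D \<Longrightarrow> adjacency_matrix q D x y = 0"
  by (simp add: adjacency_matrix_def adjacent_def)

text \<open>This is \<open>A \<otimes> 1 + 1 \<otimes> A\<close>: the sum over
  \<open>b \<noteq> a\<close> is the adjacency matrix of the complete graph applied to
  \<open>u\<close>.\<close>

lemma adjacency_tens:
  assumes "a < q"
  shows "mat_vec q (Suc D) (adjacency_matrix q (Suc D)) (tens u v) (a # x) =
    (if x \<in> vertices q D then
      (\<Sum>b\<in>{..<q} - {a}. u b) * v x + u a * mat_vec q D (adjacency_matrix q D) v x else 0)"
proof (cases "x \<in> vertices q D")
  case True
  have "mat_vec q (Suc D) (adjacency_matrix q (Suc D)) (tens u v) (a # x) =
     (\<Sum>b<q. \<Sum>y\<in>vertices q D. (if a = b then adjacency_matrix q D x y else if x = y then 1 else 0) * (u b * v y))"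
    unfolding mat_vec_apply sum_vertices_Suc
    using assms True by (auto simp: adjacency_matrix_Cons intro!: sum.cong)
  also have "\<dots> = (\<Sum>b<q. if b = a then \<Sum>y\<in>vertices q D. adjacency_matrix q D x y * (u a * v y) else u b * v x)"
    using True finite_vertices[of q D]
    by (intro sum.cong refl) (auto simp: if_distrib[of "\<lambda>c. c * _"] cong: if_cong)
  also have "\<dots> = (\<Sum>y\<in>vertices q D. adjacency_matrix q D x y * (u a * v y)) + (\<Sum>b\<in>{..<q} - {a}. u b * v x)"
    using assms by (subst sum.remove[of _ a]) (auto intro!: sum.cong)
  finally show ?thesis
    using True by (simp add: mat_vec_apply sum_distrib_left sum_distrib_right mult_ac)
qed (use assms in \<open>simp add: mat_vec_apply adjacency_matrix_outside\<close>)

lemma mat_vec_outside: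
  assumes "x \<notin> vertices q D" "A \<in> carrier (Mat (vertices q D))"
  shows "mat_vec q D A v x = 0"
  using assms by (auto simp: mat_vec_apply Mat_def)

lemma mat_vec_dual:
  "mat_vec q D (dual_adjacency_matrix q D) v x =
    (if x \<in> vertices q D then
      (of_nat D * (of_nat q - 1) - of_nat q * of_nat (hamming_dist (replicate D 0) x)) * v x else 0)"
proof -
  have "mat_vec q D (dual_adjacency_matrix q D) v x = (\<Sum>y\<in>vertices q D. if y = x then 
    (of_nat D * (of_nat q - 1) - of_nat q * of_nat (hamming_dist (replicate D 0) x)) * v x else 0)"
    unfolding mat_vec_apply dual_adjacency_matrix_def by (rule sum.cong) auto
  then show ?thesis by (simp add: finite_vertices)
qed

text \<open>The distance from the zero word is additive over coordinates, so the eigenvalue is the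
  one for a single letter plus the one for the tail.\<close>

lemma dual_tens:
  assumes "a < q"
  shows "mat_vec q (Suc D) (dual_adjacency_matrix q (Suc D)) (tens u v) (a # x) =
    (if x \<in> vertices q D then
      (of_nat q - 1 - of_nat q * (if a = 0 then 0 else 1)) * u a * v x +
      u a * mat_vec q D (dual_adjacency_matrix q D) v x else 0)"
  using assms by (simp add: mat_vec_dual hamming_dist_Cons algebra_simps)

text \<open>
  In \<open>V(1) = \<complex>\<^sup>q\<close> the vectors \<^verbatim>\<open>unit0\<close> and \<^verbatim>\<open>ones\<close> span a copy of \<open>L\<^sub>1\<^sub>,\<^sub>0(1)\<close>, and each of the
  \<open>q - 2\<close> vectors \<^verbatim>\<open>unit_diff t\<close> spans a copy of \<open>L\<^sub>0\<^sub>,\<^sub>0(1)\<close>.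
\<close>

definition unit0 :: "nat \<Rightarrow> complex" where "unit0 a = (if a = 0 then 1 else 0)"
definition ones :: "nat \<Rightarrow> nat \<Rightarrow> complex" where "ones q a = (if 0 < a \<and> a < q then 1 else 0)"
definition unit_diff :: "nat \<Rightarrow> nat \<Rightarrow> complex" where
  "unit_diff t a = (if a = 1 then 1 else if a = t + 2 then -1 else 0)"

lemma sum_unit0: "a < q \<Longrightarrow> (\<Sum>b\<in>{..<q} - {a}. unit0 b) = (if a = 0 then 0 else 1)"
  by (auto simp: sum_diff1 unit0_def)

lemma sum_ones:
  assumes "a < q" shows "(\<Sum>b\<in>{..<q} - {a}. ones q b) = of_nat q - (if a = 0 then 1 else 2)"
proof -
  have "(\<Sum>b<q. ones q b) = (\<Sum>b\<in>{1..<q}. 1)"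
    by (rule sum.mono_neutral_cong_right) (auto simp: ones_def)
  with assms show ?thesis by (auto simp: sum_diff1 ones_def of_nat_diff)
qed

text \<open>The entries of \<open>unit_diff t\<close> cancel, so the adjacency matrix of the
  complete graph, all-ones minus identity, acts on it by -1. The offset in \<open>t + 2\<close>
  skips the letters 0 and 1.\<close>

lemma sum_unit_diff:
  assumes "t < q - 2" "a < q" shows "(\<Sum>b\<in>{..<q} - {a}. unit_diff t b) = - unit_diff t a"
proof -
  have "unit_diff t = (\<lambda>b. (if b = 1 then 1 else 0) - (if b = t + 2 then 1 else 0))"
    by (auto simp: unit_diff_def)
  then have "(\<Sum>b<q. unit_diff t b) = 0"
    using assms by (simp add: sum_subtractf)
  with assms show ?thesis by (simp add: sum_diff1)
qed

text \<open>
  The basis vectors of a copy of \<open>L\<^sub>p\<^sub>,\<^sub>k(D)\<close>, continued by zero beyond the index \<open>p - 2 k\<close>, so that the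
  tridiagonal relation holds at every index.
\<close>

definition is_string :: "nat \<Rightarrow> nat \<Rightarrow> nat \<Rightarrow> nat \<Rightarrow> (nat \<Rightarrow> nat list \<Rightarrow> complex) \<Rightarrow> bool" where
  "is_string q D p k v \<longleftrightarrow> 2 * k \<le> p \<and> p \<le> D \<and>
    (\<forall>i x. x \<notin> vertices q D \<longrightarrow> v i x = 0) \<and>
    (\<forall>i>p - 2 * k. \<forall>x. v i x = 0) \<and>
    (\<forall>i x. mat_vec q D (adjacency_matrix q D) (v i) x =
       alpha q D p k i * v i x + beta i * v (Suc i) x
       + (if i = 0 then 0 else gamma q p k i * v (i - 1) x)) \<and>
    (\<forall>i x. mat_vec q D (dual_adjacency_matrix q D) (v i) x = theta q D p k i * v i x)"

definition string_sign :: "nat \<Rightarrow> (nat \<Rightarrow> nat list \<Rightarrow> complex) \<Rightarrow> nat \<Rightarrow> nat list \<Rightarrow> complex" where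
  "string_sign t v i = tens (unit_diff t) (v i)"

text \<open>
  The Clebsch--Gordan vectors: for \<open>n = p - 2 k\<close>, the tensor product of \<open>L\<^sub>1\<^sub>,\<^sub>0(1)\<close> with \<open>L\<^sub>p\<^sub>,\<^sub>k(D)\<close> is the
  sum of a string of length \<open>n + 2\<close> and one of length \<open>n\<close>.
\<close>

definition string_top :: "nat \<Rightarrow> (nat \<Rightarrow> nat list \<Rightarrow> complex) \<Rightarrow> nat \<Rightarrow> nat list \<Rightarrow> complex" where
  "string_top q v i x = tens unit0 (v i) x + (if i = 0 then 0 else tens (ones q) (v (i - 1)) x)"

definition string_bot :: "nat \<Rightarrow> nat \<Rightarrow> (nat \<Rightarrow> nat list \<Rightarrow> complex) \<Rightarrow> nat \<Rightarrow> nat list \<Rightarrow> complex" where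
  "string_bot q n v i x =
     (of_nat n - of_nat i) * tens (ones q) (v i) x - (of_nat i + 1) * tens unit0 (v (Suc i)) x"

lemma adjacency_in_Mat: "adjacency_matrix q D \<in> carrier (Mat (vertices q D))"
  and dual_adjacency_in_Mat: "dual_adjacency_matrix q D \<in> carrier (Mat (vertices q D))"
  using terwilliger_generators by blast+

text \<open>Outside \<open>vertices q D\<close> both sides of the two relations vanish, so they need
  checking only at vertices.\<close>

lemma is_stringI:
  assumes "2 * k \<le> p" "p \<le> D" "\<And>i x. x \<notin> vertices q D \<Longrightarrow> v i x = 0"
    "\<And>i x. i > p - 2 * k \<Longrightarrow> v i x = 0"
    "\<And>i x. x \<in> vertices q D \<Longrightarrow> mat_vec q D (adjacency_matrix q D) (v i) x =
       alpha q D p k i * v i x + beta i * v (Suc i) x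
       + (if i = 0 then 0 else gamma q p k i * v (i - 1) x)"
    "\<And>i x. x \<in> vertices q D \<Longrightarrow> mat_vec q D (dual_adjacency_matrix q D) (v i) x = theta q D p k i * v i x"
  shows "is_string q D p k v"
  unfolding is_string_def
proof (intro conjI allI impI)
  fix i x
  show "mat_vec q D (adjacency_matrix q D) (v i) x =
       alpha q D p k i * v i x + beta i * v (Suc i) x
       + (if i = 0 then 0 else gamma q p k i * v (i - 1) x)"
    using assms(3,5)[of x] mat_vec_outside[OF _ adjacency_in_Mat]
    by (cases "x \<in> vertices q D") auto
  show "mat_vec q D (dual_adjacency_matrix q D) (v i) x = theta q D p k i * v i x"
    using assms(3,6)[of x] mat_vec_outside[OF _ dual_adjacency_in_Mat]
    by (cases "x \<in> vertices q D") auto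
qed (use assms in auto)

lemma mat_vec_add: "mat_vec q D A (\<lambda>x. v x + w x) x = mat_vec q D A v x + mat_vec q D A w x"
  and mat_vec_diff: "mat_vec q D A (\<lambda>x. v x - w x) x = mat_vec q D A v x - mat_vec q D A w x"
  and mat_vec_scale: "mat_vec q D A (\<lambda>x. c * v x) x = c * mat_vec q D A v x"
  by (simp_all add: mat_vec_apply algebra_simps sum.distrib sum_subtractf sum_distrib_left)

lemma tens_outside:
  assumes "\<And>a. a \<ge> q \<Longrightarrow> u a = 0" "\<And>x. x \<notin> vertices q D \<Longrightarrow> v x = 0" "x \<notin> vertices q (Suc D)"
  shows "tens u v x = 0"
  using assms by (cases x) (auto simp: not_less[symmetric])

lemma units_outside:
  "q \<ge> 3 \<Longrightarrow> a \<ge> q \<Longrightarrow> unit0 a = 0" "a \<ge> q \<Longrightarrow> ones q a = 0" "t < q - 2 \<Longrightarrow> a \<ge> q \<Longrightarrow> unit_diff t a = 0"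
  by (auto simp: unit0_def ones_def unit_diff_def)

section \<open>Tensor products of a string with V(1)\<close>

context
  fixes q D p k v
  assumes s: "is_string q D p k v" and q: "q \<ge> 3"
begin

lemma string_facts:
  "2 * k \<le> p" "p \<le> D"
  "x \<notin> vertices q D \<Longrightarrow> v i x = 0"
  "i > p - 2 * k \<Longrightarrow> v i x = 0"
  "mat_vec q D (adjacency_matrix q D) (v i) x =
     alpha q D p k i * v i x + beta i * v (Suc i) x
     + (if i = 0 then 0 else gamma q p k i * v (i - 1) x)"
  "mat_vec q D (dual_adjacency_matrix q D) (v i) x = theta q D p k i * v i x"
  using s by (auto simp: is_string_def)

text \<open>Both generators act on \<open>unit_diff t\<close> by -1, which is also the change of
  \<open>alpha\<close> and \<open>theta\<close> when only D grows by 1.\<close>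

lemma is_string_sign:
  assumes t: "t < q - 2"
  shows "is_string q (Suc D) p k (string_sign t v)"
proof (rule is_stringI)
  show "2 * k \<le> p" "p \<le> Suc D" using string_facts(1,2) by auto
  show "string_sign t v i x = 0" if "x \<notin> vertices q (Suc D)" for i x
    unfolding string_sign_def by (rule tens_outside[of q _ D]) (use that t string_facts(3) units_outside in auto)
  show "string_sign t v i x = 0" if "i > p - 2 * k" for i x
    using string_facts(4)[OF that] by (cases x) (auto simp: string_sign_def)
  fix i x assume x: "x \<in> vertices q (Suc D)"
  then obtain a y where x: "x = a # y" "a < q" "y \<in> vertices q D"
    by (cases x) auto
  show "mat_vec q (Suc D) (adjacency_matrix q (Suc D)) (string_sign t v i) x =
       alpha q (Suc D) p k i * string_sign t v i x + beta i * string_sign t v (Suc i) x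
       + (if i = 0 then 0 else gamma q p k i * string_sign t v (i - 1) x)"
    using x t by (simp add: string_sign_def adjacency_tens sum_unit_diff string_facts(5) alpha_def algebra_simps)
  show "mat_vec q (Suc D) (dual_adjacency_matrix q (Suc D)) (string_sign t v i) x =
      theta q (Suc D) p k i * string_sign t v i x"
    using x t by (simp add: string_sign_def dual_tens string_facts(6) theta_def unit_diff_def algebra_simps)
qed

text \<open>At words with head 0 the values come from the \<open>unit0\<close> part, and the
  relations reduce to those of \<open>v\<close> at \<open>i\<close>; at all other words they come
  from the \<open>ones\<close> part and reduce to those of \<open>v\<close> at
  \<open>i - 1\<close>.\<close>

lemma is_string_top: "is_string q (Suc D) (Suc p) k (string_top q v)"
proof (rule is_stringI)
  show "2 * k \<le> Suc p" "Suc p \<le> Suc D" using string_facts(1,2) by auto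
  show "string_top q v i x = 0" if "x \<notin> vertices q (Suc D)" for i x
    using tens_outside[of q unit0 D "v i" x] tens_outside[of q "ones q" D "v (i-1)" x] that q string_facts(3) units_outside[of q]
    by (auto simp: string_top_def)
  show "string_top q v i x = 0" if "i > Suc p - 2 * k" for i x
    using string_facts(1) string_facts(4)[of i] string_facts(4)[of "i - 1"] that 
    by (cases x) (auto simp: string_top_def)
  fix i x assume x: "x \<in> vertices q (Suc D)"
  then obtain a y where x: "x = a # y" "a < q" "y \<in> vertices q D"
    by (cases x) auto
  have e: "unit0 a = (if a = 0 then 1 else 0)" "ones q a = (if a = 0 then 0 else 1)"
    using x by (auto simp: unit0_def ones_def)
  have mv: "mat_vec q (Suc D) A (string_top q v i) x = 
    mat_vec q (Suc D) A (tens unit0 (v i)) x + (if i = 0 then 0 else mat_vec q (Suc D) A (tens (ones q) (v (i - 1))) x)" for A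
    by (cases "i = 0") (simp_all add: string_top_def[abs_def] mat_vec_add)
  show "mat_vec q (Suc D) (adjacency_matrix q (Suc D)) (string_top q v i) x =
       alpha q (Suc D) (Suc p) k i * string_top q v i x + beta i * string_top q v (Suc i) x
       + (if i = 0 then 0 else gamma q (Suc p) k i * string_top q v (i - 1) x)"
  proof (cases i)
    case 0
    then show ?thesis unfolding mv using x q
      by (auto simp: adjacency_tens sum_unit0 sum_ones string_facts(5) string_top_def alpha_def beta_def gamma_def e algebra_simps)
  next
    case (Suc j)
    then show ?thesis unfolding mv using x q
      by (cases j) (auto simp: adjacency_tens sum_unit0 sum_ones string_facts(5) string_top_def alpha_def beta_def gamma_def e algebra_simps)
  qed
  show "mat_vec q (Suc D) (dual_adjacency_matrix q (Suc D)) (string_top q v i) x =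
      theta q (Suc D) (Suc p) k i * string_top q v i x"
    unfolding mv using x q
    by (cases i) (auto simp: dual_tens string_facts(6) theta_def string_top_def e algebra_simps)
qed

text \<open>The coefficients \<open>n - i\<close> and \<open>-(i + 1)\<close> are those of the
  product of \<open>y \<otimes> x - x \<otimes> y\<close> with the i-th vector of the symmetric
  power of degree n - 1, after clearing the denominator n. The condition \<open>0 < n\<close> is
  what admits the label \<open>(p + 1, k + 1)\<close>.\<close>

lemma is_string_bot: 
  assumes "n = p - 2 * k" "0 < n"
  shows "is_string q (Suc D) (Suc p) (Suc k) (string_bot q n v)"
proof (rule is_stringI)
  show "2 * Suc k \<le> Suc p" "Suc p \<le> Suc D" using string_facts(1,2) assms by auto
  show "string_bot q n v i x = 0" if "x \<notin> vertices q (Suc D)" for i x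
    using tens_outside[of q unit0 D "v (Suc i)" x] tens_outside[of q "ones q" D "v i" x] that q string_facts(3) units_outside[of q]
    by (auto simp: string_bot_def)
  show "string_bot q n v i x = 0" if i: "i > Suc p - 2 * Suc k" for i x
  proof (cases "i = n")
    \<comment> \<open>Here \<open>v n\<close> need not vanish, but its coefficient
      \<open>n - i\<close> does.\<close>
    case True
    then show ?thesis using string_facts(4)[of "Suc i"] assms by (cases x) (auto simp: string_bot_def)
  next
    case False
    then show ?thesis 
      using i assms string_facts(4)[of "Suc i"] string_facts(4)[of i] by (cases x) (auto simp: string_bot_def)
  qed
  fix i x assume x: "x \<in> vertices q (Suc D)"
  then obtain a y where x: "x = a # y" "a < q" "y \<in> vertices q D"
    by (cases x) auto
  have mv: "mat_vec q (Suc D) A (string_bot q n v i) x = 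
    (of_nat n - of_nat i) * mat_vec q (Suc D) A (tens (ones q) (v i)) x - (of_nat i + 1) *  mat_vec q (Suc D) A (tens unit0 (v (Suc i))) x" for A
    by (simp add: string_bot_def[abs_def] mat_vec_diff mat_vec_scale)
  have n: "of_nat p = complex_of_nat n + 2 * of_nat k"
    using assms by (simp add: of_nat_diff)
  have e: "unit0 a = (if a = 0 then 1 else 0)" "ones q a = (if a = 0 then 0 else 1)"
    using x by (auto simp: unit0_def ones_def)
  show "mat_vec q (Suc D) (adjacency_matrix q (Suc D)) (string_bot q n v i) x =
       alpha q (Suc D) (Suc p) (Suc k) i * string_bot q n v i x + beta i * string_bot q n v (Suc i) x
       + (if i = 0 then 0 else gamma q (Suc p) (Suc k) i * string_bot q n v (i - 1) x)"
    unfolding mv using x q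
    by (cases i) (auto simp: adjacency_tens sum_unit0 sum_ones string_facts(5) string_bot_def alpha_def beta_def gamma_def e n algebra_simps)
  show "mat_vec q (Suc D) (dual_adjacency_matrix q (Suc D)) (string_bot q n v i) x =
      theta q (Suc D) (Suc p) (Suc k) i * string_bot q n v i x"
    unfolding mv using x q
    by (auto simp: dual_tens string_facts(6) theta_def string_bot_def e n algebra_simps)
qed

end

section \<open>Counting the strings\<close>

type_synonym labelled_string = "(nat \<times> nat) \<times> (nat \<Rightarrow> nat list \<Rightarrow> complex)"

definition string_step :: "nat \<Rightarrow> labelled_string \<Rightarrow> labelled_string list" where
  "string_step q e = (case e of ((p, k), v) \<Rightarrow>
     map (\<lambda>t. ((p, k), string_sign t v)) [0..<q - 2] @ ((Suc p, k), string_top q v) #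
     (if 2 * k < p then [((Suc p, Suc k), string_bot q (p - 2 * k) v)] else []))"

primrec strings :: "nat \<Rightarrow> nat \<Rightarrow> labelled_string list" where
  "strings q 0 = [((0, 0), \<lambda>i x. if i = 0 \<and> x = [] then 1 else 0)]"
| "strings q (Suc D) = concat (map (string_step q) (strings q D))"

text \<open>A zero family would satisfy the relations of \<open>is_string\<close> as well; that the
  strings built here are independent is settled only later, by counting.\<close>

lemma is_string_strings:
  assumes "q \<ge> 3" "((p, k), v) \<in> set (strings q D)"
  shows "is_string q D p k v"
  using assms(2)
proof (induction D arbitrary: p k v)
  case 0
  then have [simp]: "p = 0" "k = 0" "v = (\<lambda>i x. if i = 0 \<and> x = [] then 1 else 0)" by auto
  \<comment> \<open>Only index 1, one past the end, has the nonzero vector \<open>v 0\<close> below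
    it, and there \<open>gamma\<close> vanishes. This is what allows a string to be continued by
    zero.\<close>
  have "gamma q 0 0 i = 0" if "0 < i" "i \<le> Suc 0" for i
    using that by (cases "i = 1") (auto simp: gamma_def)
  then show ?case
    by (intro is_stringI)
       (simp_all add: vertices_0 mat_vec_apply alpha_def theta_def adjacency_matrix_def adjacent_def
         hamming_dist_def dual_adjacency_matrix_def)
next
  case (Suc D)
  then obtain p' k' v' where e: "((p', k'), v') \<in> set (strings q D)"
    "((p, k), v) \<in> set (string_step q ((p', k'), v'))" by auto
  note s = Suc.IH[OF e(1)]
  have "(\<exists>t<q - 2. p = p' \<and> k = k' \<and> v = string_sign t v') \<or>
      p = Suc p' \<and> k = k' \<and> v = string_top q v' \<or>
      2 * k' < p' \<and> p = Suc p' \<and> k = Suc k' \<and> v = string_bot q (p' - 2 * k') v'"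
    using e(2) by (cases "2 * k' < p'") (auto simp: string_step_def)
  then show ?case
    using is_string_sign[OF s assms(1)] is_string_top[OF s assms(1)]
      is_string_bot[OF s assms(1) refl] by (elim disjE exE conjE) simp_all
qed

definition string_count :: "nat \<Rightarrow> nat \<Rightarrow> nat \<Rightarrow> nat \<Rightarrow> nat" where
  "string_count q D p k = length (filter (\<lambda>e. fst e = (p, k)) (strings q D))"

text \<open>Reads \<open>string_step\<close> backwards, from a label to its possible parents; the
  guards on \<open>p\<close> and \<open>k\<close> rule out truncated subtractions.\<close>

lemma string_count_step:
  "length (filter (\<lambda>e. fst e = (p, k)) (string_step q e)) =
    (if fst e = (p, k) then q - 2 else 0) + (if 0 < p \<and> fst e = (p - 1, k) then 1 else 0)
    + (if 0 < p \<and> 0 < k \<and> 2 * (k - 1) < p - 1 \<and> fst e = (p - 1, k - 1) then 1 else 0)"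
  by (cases e; cases "fst e") (auto simp: string_step_def filter_map o_def)

lemma sum_list_if_eq_length_filter:
  "(\<Sum>e\<leftarrow>xs. if P e then c else 0) = c * length (filter P xs)" for c :: nat
  by (induction xs) auto

lemma string_count_Suc:
  "string_count q (Suc D) p k = (q - 2) * string_count q D p k
    + (if 0 < p then string_count q D (p - 1) k else 0)
    + (if 0 < p \<and> 0 < k \<and> 2 * (k - 1) < p - 1 then string_count q D (p - 1) (k - 1) else 0)"
proof -
  have "string_count q (Suc D) p k = (\<Sum>e\<leftarrow>strings q D. length (filter (\<lambda>e. fst e = (p, k)) (string_step q e)))"
    by (simp add: string_count_def filter_concat length_concat o_def)
  then show ?thesis
    by (simp add: string_count_step sum_list_addf sum_list_if_eq_length_filter string_count_def)
qed

text \<open>For \<open>2 * k \<le> p\<close> these count the lattice paths with p steps, k of them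
  down, that never go below their start. Such a path records the top (up) and bottom (down) steps in
  the history of a string, leaving aside the D - p sign steps. Integers keep the subtraction exact
  for every \<open>k\<close>.\<close>

definition ballot :: "nat \<Rightarrow> nat \<Rightarrow> int" where
  "ballot p k = int (p choose k) - (if k = 0 then 0 else int (p choose (k - 1)))"

lemma ballot_Suc: "ballot (Suc p) k = ballot p k + (if k = 0 then 0 else ballot p (k - 1))"
  by (cases k; cases "k - 1") (auto simp: ballot_def)

text \<open>The two middle entries of an odd row of Pascal's triangle agree. This keeps the closed
  form correct just outside the admissible labels.\<close>

lemma ballot_eq_0: "Suc p = 2 * k \<Longrightarrow> ballot p k = 0"
  using binomial_symmetric[of k p] by (cases k) (auto simp: ballot_def)

text \<open>The entry \<open>p choose (k - 1)\<close> is \<open>k / (p - k + 1)\<close> times the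
  entry \<open>p choose k\<close>; clearing the denominator turns the difference into a
  product.\<close>

lemma ballot_mult:
  assumes "2 * k \<le> p"
  shows "int (p - k + 1) * ballot p k = int (p - 2 * k + 1) * int (p choose k)"
proof (cases k)
  case (Suc j)
  have "Suc j * (p choose Suc j) = (p - j) * (p choose j)"
    using binomial_absorb_comp[of p j] times_binomial_minus1_eq[of "Suc j" p]
    by (metis diff_Suc_1 zero_less_Suc)
  then have "int (Suc j) * int (p choose Suc j) = int (p - j) * int (p choose j)"
    by (metis of_nat_mult)
  moreover have "p - k + 1 = p - j" "int (p - 2 * k + 1) = int (p - j) - int (Suc j)"
    using assms Suc by linarith+
  ultimately show ?thesis
    using Suc by (simp add: ballot_def algebra_simps)
qed (simp add: ballot_def)

text \<open>Pascal's rule solves the recurrence twice: for the ballot numbers, where it merges the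
  two parents with smaller \<open>p\<close>, and then for \<open>D choose p\<close>.\<close>

lemma string_count_eq:
  "int (string_count q D p k) =
    (if 2 * k \<le> p \<and> p \<le> D then ballot p k * int ((D choose p) * (q - 2) ^ (D - p)) else 0)"
proof (induction D arbitrary: p k)
  case 0
  then show ?case by (auto simp: string_count_def ballot_def)
next
  case (Suc D)
  show ?case
  proof (cases "2 * k \<le> p \<and> p \<le> Suc D")
    case False
    have "string_count q D p k = 0"
      using False Suc.IH[of p k] by (metis le_Suc_eq of_nat_eq_0_iff)
    moreover have "string_count q D (p - 1) k = 0" if "0 < p"
    proof -
      have "\<not> (2 * k \<le> p - 1 \<and> p - 1 \<le> D)" using False that by linarith
      then show ?thesis using Suc.IH[of "p - 1" k] by (simp only: if_False of_nat_eq_0_iff)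
    qed
    moreover have "string_count q D (p - 1) (k - 1) = 0" if "0 < p" "0 < k" "2 * (k - 1) < p - 1"
    proof -
      \<comment> \<open>The guard amounts to \<open>2 * k \<le> p\<close>, so the label can be out
        of range only through \<open>p > D + 1\<close>.\<close>
      have "\<not> (2 * (k - 1) \<le> p - 1 \<and> p - 1 \<le> D)" using False that by linarith
      then show ?thesis using Suc.IH[of "p - 1" "k - 1"] by (simp only: if_False of_nat_eq_0_iff)
    qed
    ultimately have "string_count q (Suc D) p k = 0"
      unfolding string_count_Suc by (cases "k = 0") auto
    with False show ?thesis by (simp only: if_False of_nat_0)
  next
    case True
    show ?thesis
    proof (cases p)
      case 0
      with True show ?thesis using Suc.IH[of 0 0] by (simp add: string_count_Suc)
    next
      case p: (Suc r)
      let ?Q = "int (q - 2)"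
      \<comment> \<open>The factor \<open>q - 2\<close> is absorbed by the exponent, so that all
        three terms share the power \<open>D - r\<close>; for \<open>p = D + 1\<close> both sides
        are 0.\<close>
      have a: "?Q * int (string_count q D p k) = ballot p k * int (D choose p) * ?Q ^ (D - r)"
      proof (cases "p \<le> D")
        case le: True
        then have "D - r = Suc (D - p)" using p by simp
        then show ?thesis using True le by (simp add: Suc.IH)
      qed (simp add: Suc.IH)
      have b: "int (string_count q D r k) = ballot r k * int (D choose r) * ?Q ^ (D - r)"
      proof (cases "2 * k \<le> r")
        \<comment> \<open>Here \<open>2 * k = r + 1\<close>: no string carries this label, and the
          ballot number vanishes too.\<close>
        case False
        then have "ballot r k = 0" using True p by (intro ballot_eq_0) auto
        with False show ?thesis by (simp add: Suc.IH)
      qed (use True p in \<open>simp add: Suc.IH\<close>)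
      have c: "(if 0 < k \<and> 2 * (k - 1) < r then int (string_count q D r (k - 1)) else 0) =
          (if k = 0 then 0 else ballot r (k - 1)) * int (D choose r) * ?Q ^ (D - r)"
        using True p by (auto simp: Suc.IH)
      have bp: "ballot p k = ballot r k + (if k = 0 then 0 else ballot r (k - 1))"
        unfolding p by (rule ballot_Suc)
      have "int (string_count q (Suc D) p k) = ?Q * int (string_count q D p k) +
          int (string_count q D r k) +
          (if 0 < k \<and> 2 * (k - 1) < r then int (string_count q D r (k - 1)) else 0)"
        unfolding string_count_Suc using p by simp
      also have "\<dots> = ballot p k * int (D choose p) * ?Q ^ (D - r) + ballot p k * int (D choose r) * ?Q ^ (D - r)"
        unfolding a b c bp by (simp only: distrib_right add.assoc)
      also have "\<dots> = ballot p k * int ((Suc D choose p) * (q - 2) ^ (Suc D - p))"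
        unfolding p binomial_Suc_Suc diff_Suc_Suc of_nat_mult of_nat_add of_nat_power by (simp only: distrib_left distrib_right add.commute)
      finally show ?thesis using True by simp
    qed
  qed
qed

lemma string_count_eq_multiplicity:
  assumes "p \<le> D" "k \<le> p div 2"
  shows "string_count q D p k = multiplicity_L q D p k"
proof -
  have k: "2 * k \<le> p" using assms(2) by linarith
  have "int (p - k + 1) * int (string_count q D p k) =
      int (p - k + 1) * ballot p k * int ((D choose p) * (q - 2) ^ (D - p))"
    using k assms(1) by (simp add: string_count_eq)
  also have "\<dots> = int ((p - 2 * k + 1) * (D choose p) * (p choose k) * (q - 2) ^ (D - p))"
    unfolding ballot_mult[OF k] by (simp only: of_nat_mult mult_ac)
  finally have eq: "(p - 2 * k + 1) * (D choose p) * (p choose k) * (q - 2) ^ (D - p) = (p - k + 1) * string_count q D p k"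
    by (metis of_nat_eq_iff of_nat_mult)
  show ?thesis
    unfolding multiplicity_L_def eq by (rule nonzero_mult_div_cancel_left[symmetric]) simp
qed

text \<open>Ensures that each admissible label has a string number 0, whose span will serve as a
  model of \<open>L_{p,k}(D)\<close>.\<close>

lemma multiplicity_pos:
  assumes "q \<ge> 3" "p \<le> D" "k \<le> p div 2"
  shows "0 < multiplicity_L q D p k"
proof -
  have "real (multiplicity_L q D p k) \<noteq> 0"
    using assms by (subst multiplicity_L_eq) auto
  then show ?thesis by simp
qed

lemma sum_list_concat_map: "sum_list (map f (concat (map g xs))) = (\<Sum>x\<leftarrow>xs. sum_list (map f (g x)))"
  by (induction xs) auto

text \<open>The descendants of a string with n + 1 vectors have
  \<open>(q - 2) (n + 1) + (n + 2) + n = q (n + 1)\<close> vectors in total. For n = 0 the bottom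
  string is absent, in accordance with the summand n.\<close>

lemma sum_list_string_lengths:
  assumes "q \<ge> 3"
  shows "(\<Sum>e\<leftarrow>strings q D. fst (fst e) - 2 * snd (fst e) + 1) = q ^ D"
proof (induction D)
  case (Suc D)
  have "(\<Sum>e\<leftarrow>strings q (Suc D). fst (fst e) - 2 * snd (fst e) + 1) =
      (\<Sum>e\<leftarrow>strings q D. \<Sum>e'\<leftarrow>string_step q e. fst (fst e') - 2 * snd (fst e') + 1)"
    by (simp only: strings.simps sum_list_concat_map)
  also have "\<dots> = (\<Sum>e\<leftarrow>strings q D. q * (fst (fst e) - 2 * snd (fst e) + 1))"
  proof (intro arg_cong[of _ _ sum_list] map_cong refl)
    fix e assume e: "e \<in> set (strings q D)"
    obtain p k v where [simp]: "e = ((p, k), v)" by (metis prod.collapse)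
    have "2 * k \<le> p"
      using is_string_strings[OF assms, of p k v D] e by (simp add: is_string_def)
    then obtain n where n: "p = 2 * k + n" using le_Suc_ex by blast
    obtain r where r: "q = r + 2" using assms by (intro that[of "q - 2"]) simp
    show "(\<Sum>e'\<leftarrow>string_step q e. fst (fst e') - 2 * snd (fst e') + 1) = q * (fst (fst e) - 2 * snd (fst e) + 1)"
      by (auto simp: string_step_def n r o_def sum_list_triv algebra_simps)
  qed
  also have "\<dots> = q ^ Suc D"
    unfolding sum_list_const_mult Suc.IH by simp
  finally show ?case .
qed simp

section \<open>The strings form a basis\<close>

text \<open>Dimension theory is applied to the space of all functions on a type; V(D) becomes the
  subspace of functions supported on \<open>vertices q D\<close>.\<close>

interpretation funs: vector_space "\<lambda>(c::complex) (f::'a \<Rightarrow> complex) x. c * f x"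
  by unfold_locales (auto simp: fun_eq_iff algebra_simps)

definition delta :: "'a \<Rightarrow> 'a \<Rightarrow> complex" where "delta x y = (if y = x then 1 else 0)"

lemma span_deltas:
  assumes "finite X"
  shows "funs.span (delta ` X) = {f. \<forall>x. x \<notin> X \<longrightarrow> f x = 0}"
proof
  have "funs.subspace {f :: 'a \<Rightarrow> complex. \<forall>x. x \<notin> X \<longrightarrow> f x = 0}"
    by (auto simp: funs.subspace_def)
  then show "funs.span (delta ` X) \<subseteq> {f. \<forall>x. x \<notin> X \<longrightarrow> f x = 0}"
    by (intro funs.span_minimal) (auto simp: delta_def)
  show "{f. \<forall>x. x \<notin> X \<longrightarrow> f x = 0} \<subseteq> funs.span (delta ` X)"
  proof
    fix f :: "'a \<Rightarrow> complex" assume f: "f \<in> {f. \<forall>x. x \<notin> X \<longrightarrow> f x = 0}"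
    have "f y = (\<Sum>x\<in>X. (\<lambda>y. f x * delta x y)) y" for y
      using f assms by (simp add: sum_fun_apply delta_def if_distrib[of "\<lambda>c. _ * c"] cong: if_cong)
    then have "f = (\<Sum>x\<in>X. (\<lambda>y. f x * delta x y))" by blast
    also have "\<dots> \<in> funs.span (delta ` X)"
      by (intro funs.span_sum funs.span_scale funs.span_base) auto
    finally show "f \<in> funs.span (delta ` X)" .
  qed
qed

lemma inj_delta: "inj delta"
  by (rule injI) (metis delta_def zero_neq_one)

lemma independent_deltas:
  assumes "finite X"
  shows "funs.independent (delta ` X)"
proof -
  have "u (delta x) = 0" if "(\<Sum>v\<in>delta ` X. (\<lambda>y. u v * v y)) = 0" "x \<in> X" for u x
  proof -
    have "(\<Sum>y\<in>X. u (delta y) * delta y x) = (\<Sum>v\<in>delta ` X. (\<lambda>y. u v * v y)) x"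
      by (subst sum.reindex) (auto simp: sum_fun_apply inj_on_subset[OF inj_delta])
    also have "\<dots> = 0" using that(1) by simp
    finally show ?thesis
      using assms that(2) by (simp add: delta_def if_distrib[of "\<lambda>c. _ * c"] cong: if_cong)
  qed
  then show ?thesis
    using assms by (auto simp: funs.dependent_finite)
qed

definition string_vectors :: "nat \<Rightarrow> nat \<Rightarrow> (nat list \<Rightarrow> complex) set" where
  "string_vectors q D = {v i | p k v i. ((p, k), v) \<in> set (strings q D) \<and> i \<le> p - 2 * k}"

lemma delta_Cons: "delta (a # x) = tens (delta a) (delta x)"
proof
  fix y show "delta (a # x) y = tens (delta a) (delta x) y"
    by (cases y) (auto simp: delta_def)
qed

text \<open>Solves a linear relation for one of its vectors, with the denominator kept on the left
  so that the relation stays polynomial.\<close>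

lemma span_two_terms:
  assumes "f \<in> funs.span S" "g \<in> funs.span S" "d \<noteq> 0" "\<And>x. d * h x = a * f x + b * g x"
  shows "h \<in> funs.span S"
proof -
  have "h x = a / d * f x + b / d * g x" for x
    using assms(3) assms(4)[of x] by (simp add: divide_simps mult.commute)
  then have "h = (\<lambda>x. a / d * f x) + (\<lambda>x. b / d * g x)" by (simp add: fun_eq_iff)
  also have "\<dots> \<in> funs.span S"
    by (intro funs.span_add funs.span_scale assms(1,2))
  finally show ?thesis .
qed

text \<open>The vectors \<open>string_top\<close> at \<open>i + 1\<close> and
  \<open>string_bot\<close> at \<open>i\<close> are combinations of
  \<open>unit0 \<otimes> v (i + 1)\<close> and \<open>ones \<otimes> v i\<close> with determinant
  \<open>n + 1\<close>, so the latter can be recovered. In turn \<open>unit0\<close>,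
  \<open>ones\<close> and the \<open>unit_diff t\<close> span all functions on the letters.\<close>

lemma tens_string_in_span:
  assumes q: "q \<ge> 3" and e: "((p, k), v) \<in> set (strings q D)" and a: "a < q"
  shows "tens (delta a) (v i) \<in> funs.span (string_vectors q (Suc D))"
proof -
  let ?S = "funs.span (string_vectors q (Suc D))"
  define n where "n = p - 2 * k"
  have s: "is_string q D p k v" by (rule is_string_strings[OF q e])
  note facts = string_facts[OF s q]
  have step: "w j \<in> ?S" if "((p', k'), w) \<in> set (string_step q ((p, k), v))" "j \<le> p' - 2 * k'" for p' k' w j
  proof (rule funs.span_base)
    have "((p', k'), w) \<in> set (strings q (Suc D))" using that(1) e by auto
    with that(2) show "w j \<in> string_vectors q (Suc D)" unfolding string_vectors_def by blast
  qed
  have zero: "tens u (v j) \<in> ?S" if "j > n" for u j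
  proof -
    have "tens u (v j) = 0"
    proof
      fix x show "tens u (v j) x = 0 x" using facts(4)[of j] that by (cases x) (auto simp: n_def)
    qed
    then show ?thesis by (simp add: funs.span_zero)
  qed
  have top: "string_top q v j \<in> ?S" if "j \<le> Suc n" for j
    using that facts(1) by (intro step[of "Suc p" k "string_top q v" j]) (auto simp: string_step_def n_def)
  have bot: "string_bot q n v j \<in> ?S" if "j < n" for j
    using that by (intro step[of "Suc p" "Suc k" "string_bot q n v" j]) (auto simp: string_step_def n_def)
  have sign: "tens (unit_diff t) (v j) \<in> ?S" if "t < q - 2" for t j
  proof (cases "j \<le> n")
    case True
    then have "string_sign t v j \<in> ?S"
      using that by (intro step[of p k "string_sign t v" j]) (auto simp: string_step_def n_def)
    then show ?thesis by (simp add: string_sign_def[abs_def])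
  qed (use zero in auto)
  have n1: "complex_of_nat n + 1 \<noteq> 0"
    using of_nat_neq_0[of n, where ?'a = complex] by (simp add: add.commute)
  have e0S: "tens unit0 (v j) \<in> ?S" for j
  proof (cases "j > n")
    case False
    show ?thesis
    proof (cases j)
      case 0
      then have "string_top q v 0 = tens unit0 (v j)" by (auto simp: string_top_def)
      then show ?thesis using top[of 0] by simp
    next
      \<comment> \<open>Eliminates \<open>ones \<otimes> v i\<close> between
        \<open>string_top\<close> at \<open>j\<close> and \<open>string_bot\<close> at
        \<open>i\<close>.\<close>
      case (Suc i)
      show ?thesis
      proof (rule span_two_terms[OF top[of j] bot[of i], where a = "of_nat n - of_nat i" and b = "- 1" and d = "of_nat n + 1"])
        fix x
        show "(of_nat n + 1) * tens unit0 (v j) x = (of_nat n - of_nat i) * string_top q v j x + - 1 * string_bot q n v i x"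
          using Suc by (simp add: string_top_def string_bot_def algebra_simps)
      qed (use Suc False n1 in auto)
    qed
  qed (use zero in auto)
  have e1S: "tens (ones q) (v j) \<in> ?S" for j
  proof -
    have "n < j \<or> j = n \<or> j < n" by linarith
    then show ?thesis
    proof (elim disjE)
      assume "j = n"
      \<comment> \<open>The last top vector has no \<open>unit0\<close> part, because
        \<open>v (n + 1)\<close> is zero.\<close>
      then have "string_top q v (Suc n) = tens (ones q) (v j)"
        using facts(4)[of "Suc n"] by (auto simp: string_top_def n_def fun_eq_iff tens_def split: list.split)
      then show ?thesis using top[of "Suc n"] by simp
    next
      assume j: "j < n"
      show ?thesis
      proof (rule span_two_terms[OF top[of "Suc j"] bot[of j], where a = "of_nat j + 1" and b = 1 and d = "of_nat n + 1"])
        fix x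
        show "(of_nat n + 1) * tens (ones q) (v j) x = (of_nat j + 1) * string_top q v (Suc j) x + 1 * string_bot q n v j x"
          by (simp add: string_top_def string_bot_def algebra_simps)
      qed (use j n1 in auto)
    qed (use zero in auto)
  qed
  \<comment> \<open>\<open>q - 1\<close> times \<open>delta 1\<close> is \<open>ones\<close> plus
    the sum of all \<open>unit_diff t\<close>: that sum is \<open>q - 2\<close> at the letter 1 and
    -1 at the letters from 2 on, where it cancels \<open>ones\<close>.\<close>
  have d1: "tens (delta 1) (v i) \<in> ?S"
  proof (rule span_two_terms[OF e1S[of i] funs.span_sum[of "{..<q - 2}" "\<lambda>t. tens (unit_diff t) (v i)"], where a = 1 and b = 1 and d = "of_nat q - 1"])
    show q1: "complex_of_nat q - 1 \<noteq> 0" using q by (simp add: right_minus_eq)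
    have sum: "(\<Sum>t<q - 2. unit_diff t b) = (if b = 1 then of_nat q - 2 else if b \<ge> 2 \<and> b < q then -1 else 0)" for b
    proof -
      have "(\<Sum>t<q - 2. unit_diff t b) = (\<Sum>t<q - 2. if b = 1 then 1 else 0) - (\<Sum>t<q - 2. if t = b - 2 \<and> b \<ge> 2 then 1 else 0)"
        unfolding sum_subtractf[symmetric] by (rule sum.cong) (auto simp: unit_diff_def)
      then show ?thesis using q by (auto simp: of_nat_diff)
    qed
    show "(of_nat q - 1) * tens (delta 1) (v i) x = 1 * tens (ones q) (v i) x + 1 * (\<Sum>t<q - 2. tens (unit_diff t) (v i)) x" for x
    proof (cases x)
      case (Cons b y)
      have "(\<Sum>t<q - 2. tens (unit_diff t) (v i)) x = (\<Sum>t<q - 2. unit_diff t b) * v i y"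
        unfolding Cons by (simp add: sum_fun_apply sum_distrib_right)
      then show ?thesis
        using q unfolding sum Cons by (auto simp: delta_def ones_def algebra_simps)
    qed (simp add: sum_fun_apply)
  qed (use sign in auto)
  show ?thesis
  proof -
    have "a = 0 \<or> a = 1 \<or> a \<ge> 2" by linarith
    then show ?thesis
    proof (elim disjE)
      assume "a = 0"
      then have "delta a = unit0" by (auto simp: delta_def unit0_def)
      then show ?thesis using e0S by simp
    next
      \<comment> \<open>Uses that \<open>delta a\<close> is \<open>delta 1\<close> minus
        \<open>unit_diff (a - 2)\<close>.\<close>
      assume "a \<ge> 2"
      then have "a - 2 < q - 2" "a - 2 + 2 = a" using a by auto
      then show ?thesis
        by (intro span_two_terms[OF d1 sign[of "a - 2" i], where a = 1 and b = "-1" and d = 1])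
           (auto simp: tens_def delta_def unit_diff_def split: list.split)
    qed (use d1 in simp)
  qed
qed

text \<open>Tensoring with \<open>delta a\<close> is linear, so the induction step only has to treat
  the vectors of the strings for D.\<close>

lemma delta_in_span:
  assumes q: "q \<ge> 3" and "x \<in> vertices q D"
  shows "delta x \<in> funs.span (string_vectors q D)"
  using assms(2)
proof (induction D arbitrary: x)
  case 0
  then have "delta x = (\<lambda>i x. if i = 0 \<and> x = [] then 1 else 0) (0::nat)"
    by (auto simp: vertices_0 delta_def)
  then show ?case
    by (intro funs.span_base) (auto simp: string_vectors_def)
next
  case (Suc D)
  then obtain a y where x: "x = a # y" "a < q" "y \<in> vertices q D"
    by (cases x) auto
  have "tens (delta a) f \<in> funs.span (string_vectors q (Suc D))"
    if "f \<in> funs.span (string_vectors q D)" for f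
    using that
  proof (induction rule: funs.span_induct)
    case base
    have eq: "tens (delta a) 0 = 0"
      "tens (delta a) (\<lambda>x. c * f x) = (\<lambda>x. c * tens (delta a) f x)"
      "tens (delta a) (f + g) = tens (delta a) f + tens (delta a) g" for c f g
      by (auto simp: fun_eq_iff tens_def algebra_simps split: list.split)
    show ?case
      by (auto simp: funs.subspace_def eq intro: funs.span_zero funs.span_add funs.span_scale)
  next
    case (step f)
    then show ?case using tens_string_in_span[OF q _ x(2)] by (auto simp: string_vectors_def)
  qed
  with Suc.IH[OF x(3)] show ?case by (simp add: x(1) delta_Cons)
qed

lemma card_vertices: "card (vertices q D) = q ^ D"
  using card_lists_length_eq[of "{0..<q}" D] by (simp add: vertices_def conj_commute)

definition string_at :: "nat \<Rightarrow> nat \<Rightarrow> nat \<Rightarrow> nat \<Rightarrow> nat \<Rightarrow> nat \<Rightarrow> nat list \<Rightarrow> complex" where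
  "string_at q D p k j = snd (filter (\<lambda>e. fst e = (p, k)) (strings q D) ! j)"

lemma string_at_in_strings:
  assumes "j < string_count q D p k"
  shows "((p, k), string_at q D p k j) \<in> set (strings q D)"
  using nth_mem[of j "filter (\<lambda>e. fst e = (p, k)) (strings q D)"] assms
  by (auto simp: string_count_def string_at_def) (metis prod.collapse)

text \<open>Nested and bounded as in the direct sum of the theorem, so that
  \<open>(p, k, j, i)\<close> is position i in copy j of \<open>L_{p,k}(D)\<close>.\<close>

definition string_index :: "nat \<Rightarrow> nat \<Rightarrow> (nat \<times> nat \<times> nat \<times> nat) set" where
  "string_index q D =
    (SIGMA p:{..D}. SIGMA k:{..p div 2}. {..<multiplicity_L q D p k} \<times> {..<p - 2 * k + 1})"

fun string_basis :: "nat \<Rightarrow> nat \<Rightarrow> nat \<times> nat \<times> nat \<times> nat \<Rightarrow> nat list \<Rightarrow> complex" where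
  "string_basis q D (p, k, j, i) = string_at q D p k j i"

lemma finite_string_index: "finite (string_index q D)"
  by (auto simp: string_index_def)

lemma string_basis_image:
  assumes q: "q \<ge> 3"
  shows "string_basis q D ` string_index q D = string_vectors q D"
proof
  show "string_basis q D ` string_index q D \<subseteq> string_vectors q D"
  proof
    fix w assume "w \<in> string_basis q D ` string_index q D"
    then obtain p k j i where s: "(p, k, j, i) \<in> string_index q D" "w = string_at q D p k j i"
      by fastforce
    then have "((p, k), string_at q D p k j) \<in> set (strings q D)" "i \<le> p - 2 * k"
      by (auto simp: string_index_def string_count_eq_multiplicity intro!: string_at_in_strings)
    then show "w \<in> string_vectors q D"
      unfolding string_vectors_def s(2) by blast
  qed
  show "string_vectors q D \<subseteq> string_basis q D ` string_index q D"
  proof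
    fix w assume "w \<in> string_vectors q D"
    then obtain p k v i where w: "w = v i" "((p, k), v) \<in> set (strings q D)" "i \<le> p - 2 * k"
      by (auto simp: string_vectors_def)
    have pk: "k \<le> p div 2" "p \<le> D"
      using is_string_strings[OF q w(2)] by (auto simp: is_string_def)
    have "((p, k), v) \<in> set (filter (\<lambda>e. fst e = (p, k)) (strings q D))" using w(2) by simp
    then obtain j where "j < string_count q D p k" "filter (\<lambda>e. fst e = (p, k)) (strings q D) ! j = ((p, k), v)"
      unfolding in_set_conv_nth string_count_def by blast
    then have "w = string_basis q D (p, k, j, i)" "(p, k, j, i) \<in> string_index q D"
      using w(1,3) pk by (auto simp: string_at_def string_index_def string_count_eq_multiplicity)
    then show "w \<in> string_basis q D ` string_index q D" by blast
  qed
qed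

text \<open>Grouping the list \<open>strings q D\<close> by labels turns its total length into the
  sum over \<open>(p, k)\<close>.\<close>

lemma card_string_index:
  assumes q: "q \<ge> 3"
  shows "card (string_index q D) = q ^ D"
proof -
  let ?g = "\<lambda>(p, k). p - 2 * k + 1" and ?L = "SIGMA p:{..D}. {..p div 2}"
  have "card (string_index q D) = (\<Sum>(p, k)\<in>?L. multiplicity_L q D p k * (p - 2 * k + 1))"
    by (simp add: string_index_def sum.Sigma card_cartesian_product del: mult_Suc_right)
  also have "\<dots> = (\<Sum>l\<in>?L. count_list (map fst (strings q D)) l * ?g l)"
  proof (rule sum.cong[OF refl])
    fix l assume "l \<in> ?L"
    then obtain p k where l: "l = (p, k)" "p \<le> D" "k \<le> p div 2" by auto
    then have "multiplicity_L q D p k = string_count q D p k"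
      by (simp add: string_count_eq_multiplicity)
    also have "\<dots> = count_list (map fst (strings q D)) (p, k)"
      unfolding string_count_def count_list_eq_length_filter by (simp add: filter_map o_def eq_commute)
    finally show "(case l of (p, k) \<Rightarrow> multiplicity_L q D p k * (p - 2 * k + 1)) =
        count_list (map fst (strings q D)) l * ?g l"
      using l(1) by simp
  qed
  also have "\<dots> = sum_list (map ?g (map fst (strings q D)))"
  proof -
    have "set (map fst (strings q D)) \<subseteq> ?L"
      using is_string_strings[OF q] by (force simp: is_string_def)
    then show ?thesis
      by (intro sum_list_map_eq_sum_count2[symmetric]) auto
  qed
  also have "\<dots> = q ^ D"
    using sum_list_string_lengths[OF q, of D] by (simp add: o_def case_prod_beta)
  finally show ?thesis .
qed

text \<open>The family spans a space of dimension \<open>q ^ D\<close> and has only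
  \<open>q ^ D\<close> indices, which leaves no room for a relation or a repetition.\<close>

lemma string_basis_is_basis:
  assumes q: "q \<ge> 3"
  shows "inj_on (string_basis q D) (string_index q D)"
    and "funs.independent (string_basis q D ` string_index q D)"
    and "funs.span (string_basis q D ` string_index q D) = {f. \<forall>x. x \<notin> vertices q D \<longrightarrow> f x = 0}"
proof -
  let ?V = "{f. \<forall>x. x \<notin> vertices q D \<longrightarrow> f x = (0::complex)}"
  let ?B = "string_basis q D ` string_index q D"
  have V: "?V = funs.span (delta ` vertices q D)"
    by (simp add: span_deltas finite_vertices)
  have "card (delta ` vertices q D) = q ^ D"
    by (simp add: card_image inj_on_subset[OF inj_delta] card_vertices)
  then have dim: "funs.dim ?V = q ^ D"
    unfolding V funs.dim_span
    by (simp add: funs.dim_eq_card_independent[OF independent_deltas[OF finite_vertices]])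
  have le: "card ?B \<le> q ^ D"
    using card_image_le[OF finite_string_index[of q D], of "string_basis q D"] by (simp add: card_string_index[OF q])
  have BV: "?B \<subseteq> ?V"
    unfolding string_basis_image[OF q]
    using is_string_strings[OF q] by (force simp: string_vectors_def is_string_def)
  have VB: "?V \<subseteq> funs.span ?B"
    unfolding V string_basis_image[OF q]
    by (rule funs.span_minimal) (use delta_in_span[OF q] in auto)
  have "funs.subspace ?V" unfolding V by (rule funs.subspace_span)
  then show sp: "funs.span ?B = ?V"
    by (intro subset_antisym VB funs.span_minimal BV)
  show indep: "funs.independent ?B"
  proof -
    \<comment> \<open>\<open>C\<close> still spans, so it has \<open>q ^ D\<close> elements;
      \<open>?B\<close> has at most that many, so nothing was discarded.\<close>
    obtain C where C: "C \<subseteq> ?B" "funs.independent C" "?B \<subseteq> funs.span C"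
      using funs.maximal_independent_subset by blast
    have "funs.span C = funs.span ?B"
      by (intro subset_antisym funs.span_mono C(1) funs.span_minimal C(3) funs.subspace_span)
    then have "funs.span C = funs.span ?V"
      by (simp only: sp[symmetric] funs.span_span)
    then have "funs.dim ?V = card C"
      by (rule funs.dim_eq_card[OF _ C(2)])
    then have "card C = q ^ D" using dim by (rule trans[OF sym])
    then have "card ?B \<le> card C" using le by simp
    then have "C = ?B"
      using C(1) finite_string_index by (meson card_seteq finite_imageI)
    with C(2) show ?thesis by simp
  qed
  have "card ?B = q ^ D"
    using dim unfolding sp[symmetric] funs.dim_span by (simp add: funs.dim_eq_card_independent[OF indep])
  then show "inj_on (string_basis q D) (string_index q D)"
    by (intro eq_card_imp_inj_on finite_string_index) (simp add: card_string_index[OF q])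
qed

lemma string_basis_coordinates:
  assumes "q \<ge> 3" "\<And>x. x \<notin> vertices q D \<Longrightarrow> f x = 0"
  shows "\<exists>c. \<forall>x. f x = (\<Sum>s\<in>string_index q D. c s * string_basis q D s x)"
proof -
  have "f \<in> funs.span (string_basis q D ` string_index q D)"
    unfolding string_basis_is_basis(3)[OF assms(1)] using assms(2) by simp
  then obtain u where "f = (\<Sum>v\<in>string_basis q D ` string_index q D. (\<lambda>x. u v * v x))"
    by (auto simp: funs.span_finite[OF finite_imageI[OF finite_string_index]])
  then have "f = (\<Sum>s\<in>string_index q D. (\<lambda>x. u (string_basis q D s) * string_basis q D s x))"
    by (simp add: sum.reindex[OF string_basis_is_basis(1)[OF assms(1)]] o_def)
  then show ?thesis by (intro exI[of _ "\<lambda>s. u (string_basis q D s)"]) (simp add: sum_fun_apply)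
qed

lemma string_basis_unique:
  assumes q: "q \<ge> 3" and z: "\<And>x. (\<Sum>s\<in>string_index q D. c s * string_basis q D s x) = 0"
    and s: "s \<in> string_index q D"
  shows "c s = 0"
proof -
  let ?B = "string_basis q D ` string_index q D"
  let ?u = "\<lambda>v. c (the_inv_into (string_index q D) (string_basis q D) v)"
  have inj: "inj_on (string_basis q D) (string_index q D)" by (rule string_basis_is_basis(1)[OF q])
  have "(\<Sum>v\<in>?B. (\<lambda>x. ?u v * v x)) = 0"
    by (auto simp: sum.reindex[OF inj] the_inv_into_f_f[OF inj] fun_eq_iff sum_fun_apply z cong: sum.cong)
  then have "?u (string_basis q D s) = 0"
    using string_basis_is_basis(2)[OF q] s
    by (intro funs.independentD[of ?B ?B ?u]) (auto simp: finite_string_index)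
  then show ?thesis using the_inv_into_f_f[OF inj s] by simp
qed

section \<open>Modules over the Terwilliger algebra\<close>

lemma terwilliger_simps [simp]:
  "add (terwilliger q D) = add (Mat (vertices q D))"
  "mult (terwilliger q D) = mult (Mat (vertices q D))"
  "one (terwilliger q D) = one (Mat (vertices q D))"
  "smult (terwilliger q D) = smult (Mat (vertices q D))"
  by (simp_all add: terwilliger_def generated_subalgebra_def)

abbreviation scalar :: "nat \<Rightarrow> nat \<Rightarrow> complex \<Rightarrow> nat list sqmat" where
  "scalar q D c \<equiv> c \<odot>\<^bsub>terwilliger q D\<^esub> \<one>\<^bsub>terwilliger q D\<^esub>"

lemma carrier_terwilliger:
  "carrier (terwilliger q D) = generate_ring (Mat (vertices q D))
     ({adjacency_matrix q D, dual_adjacency_matrix q D} \<union> range (scalar q D))"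
  by (simp add: terwilliger_def generated_subalgebra_def)

lemma terwilliger_subset_Mat: "carrier (terwilliger q D) \<subseteq> carrier (Mat (vertices q D))"
  using ring.generate_ring_incl[OF ring_Mat[OF finite_vertices] terwilliger_generators]
  by (simp add: terwilliger_def generated_subalgebra_def)

lemma adjacency_in_terwilliger: "adjacency_matrix q D \<in> carrier (terwilliger q D)"
  and dual_adjacency_in_terwilliger: "dual_adjacency_matrix q D \<in> carrier (terwilliger q D)"
  and scalar_in_terwilliger: "scalar q D c \<in> carrier (terwilliger q D)"
  unfolding carrier_terwilliger by (auto intro: generate_ring.incl)

lemma scalar_eq: "scalar q D c = (\<lambda>x y. if x \<in> vertices q D \<and> x = y then c else 0)"
  by (auto simp: Mat_def fun_eq_iff)

lemma scalar_mult:
  assumes "A \<in> carrier (Mat (vertices q D))"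
  shows "scalar q D c \<otimes>\<^bsub>terwilliger q D\<^esub> A = (\<lambda>x y. c * A x y)"
    and "A \<otimes>\<^bsub>terwilliger q D\<^esub> scalar q D c = (\<lambda>x y. c * A x y)"
proof -
  have "(\<Sum>z\<in>vertices q D. (if x \<in> vertices q D \<and> x = z then c else 0) * A z y) = c * A x y" for x y
  proof (cases "x \<in> vertices q D")
    case True
    then have "(\<Sum>z\<in>vertices q D. (if x \<in> vertices q D \<and> x = z then c else 0) * A z y) =
        (\<Sum>z\<in>vertices q D. if z = x then c * A x y else 0)"
      by (intro sum.cong) auto
    with True show ?thesis by (simp add: finite_vertices)
  qed (use assms in \<open>simp add: Mat_def\<close>)
  then show "scalar q D c \<otimes>\<^bsub>terwilliger q D\<^esub> A = (\<lambda>x y. c * A x y)"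
    unfolding scalar_eq by (simp add: Mat_def)
  have "(\<Sum>z\<in>vertices q D. A x z * (if z \<in> vertices q D \<and> z = y then c else 0)) = c * A x y" for x y
  proof (cases "y \<in> vertices q D")
    case True
    then have "(\<Sum>z\<in>vertices q D. A x z * (if z \<in> vertices q D \<and> z = y then c else 0)) =
        (\<Sum>z\<in>vertices q D. if z = y then c * A x y else 0)"
      by (intro sum.cong) auto
    with True show ?thesis by (simp add: finite_vertices)
  qed (use assms in \<open>auto simp: Mat_def intro!: sum.neutral\<close>)
  then show "A \<otimes>\<^bsub>terwilliger q D\<^esub> scalar q D c = (\<lambda>x y. c * A x y)"
    unfolding scalar_eq by (simp add: Mat_def)
qed

text \<open>The cases of \<open>generate_ring\<close> for the unit and for additive inverses are
  absorbed by the scalars 1 and -1.\<close>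

lemma terwilliger_induct [consumes 1, case_names adjacency dual_adjacency scalar add mult]:
  assumes a: "a \<in> carrier (terwilliger q D)"
    and "P (adjacency_matrix q D)" "P (dual_adjacency_matrix q D)"
    and scalar: "\<And>c. P (scalar q D c)"
    and add: "\<And>a b. \<lbrakk>a \<in> carrier (terwilliger q D); b \<in> carrier (terwilliger q D); P a; P b\<rbrakk>
      \<Longrightarrow> P (a \<oplus>\<^bsub>terwilliger q D\<^esub> b)"
    and mult: "\<And>a b. \<lbrakk>a \<in> carrier (terwilliger q D); b \<in> carrier (terwilliger q D); P a; P b\<rbrakk>
      \<Longrightarrow> P (a \<otimes>\<^bsub>terwilliger q D\<^esub> b)"
  shows "P a"
  using a unfolding carrier_terwilliger
proof (induction rule: generate_ring.induct)
  case one
  have "\<one>\<^bsub>Mat (vertices q D)\<^esub> = scalar q D 1" by (simp add: Mat_def)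
  then show ?case using scalar by metis
next
  case (incl h)
  then show ?case using assms(2,3) scalar by auto
next
  case (a_inv h)
  then have h: "h \<in> carrier (terwilliger q D)" by (simp add: carrier_terwilliger)
  then have hM: "h \<in> carrier (Mat (vertices q D))" using terwilliger_subset_Mat by blast
  interpret ring "Mat (vertices q D)" by (rule ring_Mat[OF finite_vertices])
  have eq: "scalar q D (-1) \<otimes>\<^bsub>terwilliger q D\<^esub> h = (\<lambda>x y. - h x y)"
    unfolding scalar_mult(1)[OF hM] by simp
  have "\<ominus>\<^bsub>Mat (vertices q D)\<^esub> h = scalar q D (-1) \<otimes>\<^bsub>terwilliger q D\<^esub> h"
    unfolding eq using hM by (intro minus_equality) (auto simp: Mat_def)
  then show ?case
    using mult[OF scalar_in_terwilliger h scalar a_inv.IH] by simp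
next
  case (eng_add h1 h2)
  then show ?case using add[of h1 h2] by (simp add: carrier_terwilliger)
next
  case (eng_mult h1 h2)
  then show ?case using mult[of h1 h2] by (simp add: carrier_terwilliger)
qed

text \<open>The algebra elements that commute with \<open>f\<close> are closed under sums and
  products, so the generators and the scalars decide.\<close>

lemma equivariantI:
  assumes M: "left_module (terwilliger q D) M" and N: "left_module (terwilliger q D) N"
    and f: "\<And>x. x \<in> carrier M \<Longrightarrow> f x \<in> carrier N"
    and add: "\<And>x y. x \<in> carrier M \<Longrightarrow> y \<in> carrier M \<Longrightarrow> f (x \<oplus>\<^bsub>M\<^esub> y) = f x \<oplus>\<^bsub>N\<^esub> f y"
    and gens: "\<And>x. x \<in> carrier M \<Longrightarrow> f (adjacency_matrix q D \<odot>\<^bsub>M\<^esub> x) = adjacency_matrix q D \<odot>\<^bsub>N\<^esub> f x"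
      "\<And>x. x \<in> carrier M \<Longrightarrow> f (dual_adjacency_matrix q D \<odot>\<^bsub>M\<^esub> x) = dual_adjacency_matrix q D \<odot>\<^bsub>N\<^esub> f x"
      "\<And>x c. x \<in> carrier M \<Longrightarrow> f (scalar q D c \<odot>\<^bsub>M\<^esub> x) = scalar q D c \<odot>\<^bsub>N\<^esub> f x"
    and a: "a \<in> carrier (terwilliger q D)" and x: "x \<in> carrier M"
  shows "f (a \<odot>\<^bsub>M\<^esub> x) = a \<odot>\<^bsub>N\<^esub> f x"
  using a x
proof (induction arbitrary: x rule: terwilliger_induct)
  case (add a b)
  then show ?case
    by (metis (no_types, lifting) M N assms(4) f left_module.smult_closed left_module.smult_l_distr)
next
  case (mult a b)
  then show ?case
    by (metis (no_types, lifting) M N f left_module.smult_closed left_module.smult_assoc)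
qed (use gens in auto)

section \<open>Coordinates with respect to an ordered basis\<close>

definition basis_comb :: "(complex, 'b) module \<Rightarrow> nat \<Rightarrow> (nat \<Rightarrow> 'b) \<Rightarrow> (nat \<Rightarrow> complex) \<Rightarrow> 'b" where
  "basis_comb W n v c = (\<Oplus>\<^bsub>W\<^esub>i\<in>{..<n}. c i \<odot>\<^bsub>W\<^esub> v i)"

lemma lincomb_image_eq_basis_comb:
  assumes W: "vectorspace class_ring W" and V: "v \<in> {..<n} \<rightarrow> carrier W" and inj: "inj_on v {..<n}"
  shows "module.lincomb W a (v ` {..<n}) = basis_comb W n v (a \<circ> v)"
proof -
  interpret vectorspace class_ring W by fact
  have v: "\<And>i. i < n \<Longrightarrow> v i \<in> carrier W" using V by auto
  show ?thesis
    unfolding lincomb_def basis_comb_def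
    by (subst finsum_reindex[OF _ inj]) (auto simp: v)
qed

text \<open>\<open>basis\<close> speaks of a set and attaches coefficients to vectors; here they are
  attached to positions, which also captures injectivity of \<open>v\<close>. Coefficient sequences
  are total, hence uniqueness only below \<open>n\<close>.\<close>

lemma ordered_basis_iff:
  assumes W: "vectorspace class_ring W" and V: "v \<in> {..<n} \<rightarrow> carrier W"
  shows "ordered_basis W n v \<longleftrightarrow>
    (\<forall>x\<in>carrier W. \<exists>c. basis_comb W n v c = x) \<and>
    (\<forall>c d. basis_comb W n v c = basis_comb W n v d \<longrightarrow> (\<forall>i<n. c i = d i))"
proof -
  interpret vectorspace class_ring W by fact
  have v: "\<And>i. i < n \<Longrightarrow> v i \<in> carrier W" using V by auto
  have crit: "basis (v ` {..<n}) \<longleftrightarrow>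
      (\<forall>x. x \<in> carrier W \<longrightarrow> (\<exists>!a. a \<in> v ` {..<n} \<rightarrow>\<^sub>E UNIV \<and> lincomb a (v ` {..<n}) = x))"
    using v by (subst basis_criterion) auto
  have cong: "basis_comb W n v c = basis_comb W n v d" if "\<And>i. i < n \<Longrightarrow> c i = d i" for c d
    unfolding basis_comb_def using that v by (intro finsum_cong') auto
  have closed: "basis_comb W n v c \<in> carrier W" for c
    unfolding basis_comb_def using v by (intro finsum_closed) auto
  show ?thesis
  proof
    assume "ordered_basis W n v"
    then have inj: "inj_on v {..<n}" and b: "basis (v ` {..<n})"
      by (auto simp: ordered_basis_def)
    note lin = lincomb_image_eq_basis_comb[OF W V inj]
    \<comment> \<open>\<open>r c\<close> moves a sequence to the image of \<open>v\<close> and makes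
      it extensional, as the criterion for bases demands.\<close>
    define r where "r = (\<lambda>c :: nat \<Rightarrow> complex. restrict (c \<circ> the_inv_into {..<n} v) (v ` {..<n}))"
    have r: "r c (v i) = c i" if "i < n" for c :: "nat \<Rightarrow> complex" and i
      using that by (simp add: r_def the_inv_into_f_f[OF inj])
    have rE: "r c \<in> v ` {..<n} \<rightarrow>\<^sub>E UNIV" for c by (auto simp: r_def)
    have lr: "lincomb (r c) (v ` {..<n}) = basis_comb W n v c" for c
      by (simp add: lin) (rule cong, simp add: r)
    have "c i = d i" if "basis_comb W n v c = basis_comb W n v d" "i < n" for c d i
    proof -
      have "r c = r d"
        using b[unfolded crit] closed[of c] rE lr that(1) by metis
      then show ?thesis using r that(2) by metis
    qed
    moreover have "\<exists>c. basis_comb W n v c = x" if "x \<in> carrier W" for x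
      using b[unfolded crit] that lin by metis
    ultimately show "(\<forall>x\<in>carrier W. \<exists>c. basis_comb W n v c = x) \<and>
      (\<forall>c d. basis_comb W n v c = basis_comb W n v d \<longrightarrow> (\<forall>i<n. c i = d i))" by blast
  next
    assume A: "(\<forall>x\<in>carrier W. \<exists>c. basis_comb W n v c = x) \<and>
      (\<forall>c d. basis_comb W n v c = basis_comb W n v d \<longrightarrow> (\<forall>i<n. c i = d i))"
    have unit: "basis_comb W n v (\<lambda>j. if j = i then 1 else 0) = v i" if "i < n" for i
    proof -
      have "basis_comb W n v (\<lambda>j. if j = i then 1 else 0) = (\<Oplus>\<^bsub>W\<^esub>j\<in>{..<n}. if i = j then v j else \<zero>\<^bsub>W\<^esub>)"
        unfolding basis_comb_def using v by (intro finsum_cong') (auto simp: lmult_0[simplified class_ring_simps] smult_one[simplified class_ring_simps])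
      then show ?thesis using that v by (simp add: finsum_singleton)
    qed
    have inj: "inj_on v {..<n}"
    proof (rule inj_onI)
      \<comment> \<open>A repeated vector would have two different coordinate sequences.\<close>
      fix i j assume ij: "i \<in> {..<n}" "j \<in> {..<n}" "v i = v j"
      then have "basis_comb W n v (\<lambda>l. if l = i then 1 else 0) = basis_comb W n v (\<lambda>l. if l = j then 1 else 0)"
        by (simp add: unit)
      then have "(if i = i then 1 else 0 :: complex) = (if i = j then 1 else 0)"
        using A ij(1) by blast
      then show "i = j" by (simp split: if_splits)
    qed
    note lin = lincomb_image_eq_basis_comb[OF W V inj]
    define r where "r = (\<lambda>c :: nat \<Rightarrow> complex. restrict (c \<circ> the_inv_into {..<n} v) (v ` {..<n}))"
    have r: "r c (v i) = c i" if "i < n" for c :: "nat \<Rightarrow> complex" and i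
      using that by (simp add: r_def the_inv_into_f_f[OF inj])
    have rE: "r c \<in> v ` {..<n} \<rightarrow>\<^sub>E UNIV" for c by (auto simp: r_def)
    have lr: "lincomb (r c) (v ` {..<n}) = basis_comb W n v c" for c
      by (simp add: lin) (rule cong, simp add: r)
    have "basis (v ` {..<n})"
      unfolding crit
    proof (intro allI impI ex_ex1I)
      fix x assume "x \<in> carrier W"
      then show "\<exists>a. a \<in> v ` {..<n} \<rightarrow>\<^sub>E UNIV \<and> lincomb a (v ` {..<n}) = x"
        using A rE lr by metis
    next
      fix x a b
      assume a: "a \<in> v ` {..<n} \<rightarrow>\<^sub>E UNIV \<and> lincomb a (v ` {..<n}) = x"
        and b: "b \<in> v ` {..<n} \<rightarrow>\<^sub>E UNIV \<and> lincomb b (v ` {..<n}) = x"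
      then have "\<forall>i<n. (a \<circ> v) i = (b \<circ> v) i" using A lin by metis
      then show "a = b"
        using PiE_ext[OF conjunct1[OF a] conjunct1[OF b]] by auto
    qed
    with inj show "ordered_basis W n v" by (simp add: ordered_basis_def)
  qed
qed

lemma basis_comb_linear:
  assumes W: "vectorspace class_ring W" and V: "v \<in> {..<n} \<rightarrow> carrier W"
  shows "basis_comb W n v c \<in> carrier W"
    and "basis_comb W n v (\<lambda>i. c i + d i) = basis_comb W n v c \<oplus>\<^bsub>W\<^esub> basis_comb W n v d"
    and "basis_comb W n v (\<lambda>i. s * c i) = s \<odot>\<^bsub>W\<^esub> basis_comb W n v c"
    and "(\<And>i. i < n \<Longrightarrow> c i = d i) \<Longrightarrow> basis_comb W n v c = basis_comb W n v d"
proof -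
  interpret vectorspace class_ring W by fact
  have v: "\<And>i. i < n \<Longrightarrow> v i \<in> carrier W" using V by auto
  have cl: "(\<lambda>i. c i \<odot>\<^bsub>W\<^esub> v i) \<in> {..<n} \<rightarrow> carrier W" for c using v by auto
  show "basis_comb W n v c \<in> carrier W"
    unfolding basis_comb_def by (intro finsum_closed cl)
  show "basis_comb W n v (\<lambda>i. c i + d i) = basis_comb W n v c \<oplus>\<^bsub>W\<^esub> basis_comb W n v d"
    unfolding basis_comb_def
    by (subst finsum_addf[symmetric, OF cl cl], intro finsum_cong') (use v smult_l_distr in auto)
  show "basis_comb W n v (\<lambda>i. s * c i) = s \<odot>\<^bsub>W\<^esub> basis_comb W n v c"
    unfolding basis_comb_def
    by (subst finsum_smult[OF _ cl], simp, intro finsum_cong') (use v smult_assoc1 in auto)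
  show "basis_comb W n v c = basis_comb W n v d" if "\<And>i. i < n \<Longrightarrow> c i = d i"
    unfolding basis_comb_def using that v by (intro finsum_cong') auto
qed

lemma complex_space_simps [simp]:
  "carrier (complex_space A M) = carrier M" "zero (complex_space A M) = zero M"
  "add (complex_space A M) = add M" "smult (complex_space A M) c x = (c \<odot>\<^bsub>A\<^esub> \<one>\<^bsub>A\<^esub>) \<odot>\<^bsub>M\<^esub> x"
  by (simp_all add: complex_space_def)

lemma finsum_complex_space: "finsum (complex_space A M) f X = finsum M f X"
  by (simp add: finsum_def finprod_def complex_space_def)

lemma smult_zero_right:
  assumes "left_module R M" "a \<in> carrier R"
  shows "a \<odot>\<^bsub>M\<^esub> \<zero>\<^bsub>M\<^esub> = \<zero>\<^bsub>M\<^esub>"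
proof -
  interpret left_module R M by fact
  have "a \<odot>\<^bsub>M\<^esub> \<zero>\<^bsub>M\<^esub> \<oplus>\<^bsub>M\<^esub> a \<odot>\<^bsub>M\<^esub> \<zero>\<^bsub>M\<^esub> = a \<odot>\<^bsub>M\<^esub> \<zero>\<^bsub>M\<^esub>"
    using smult_r_distr[OF assms(2), of "\<zero>\<^bsub>M\<^esub>" "\<zero>\<^bsub>M\<^esub>"] by simp
  then show ?thesis
    using smult_closed[OF assms(2), of "\<zero>\<^bsub>M\<^esub>"] by (simp add: M.add.l_cancel_one)
qed

lemma scalar_commute:
  assumes "left_module (terwilliger q D) M" "a \<in> carrier (terwilliger q D)" "x \<in> carrier M"
  shows "a \<odot>\<^bsub>M\<^esub> (scalar q D c \<odot>\<^bsub>M\<^esub> x) = scalar q D c \<odot>\<^bsub>M\<^esub> (a \<odot>\<^bsub>M\<^esub> x)"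
proof -
  interpret left_module "terwilliger q D" M by fact
  have "a \<in> carrier (Mat (vertices q D))" using assms(2) terwilliger_subset_Mat by blast
  then have "a \<otimes>\<^bsub>terwilliger q D\<^esub> scalar q D c = scalar q D c \<otimes>\<^bsub>terwilliger q D\<^esub> a"
    by (simp only: scalar_mult)
  then show ?thesis
    using assms(2,3) scalar_in_terwilliger by (metis smult_assoc)
qed

text \<open>\<open>acts_by\<close> only describes the images of the basis vectors; additivity and
  the centrality of scalars extend this to all coordinates.\<close>

lemma acts_by_basis_comb:
  assumes L: "left_module (terwilliger q D) L"
    and V: "v \<in> {..<n} \<rightarrow> carrier L"
    and a: "a \<in> carrier (terwilliger q D)"
    and act: "acts_by (terwilliger q D) L n v a B"
  shows "a \<odot>\<^bsub>L\<^esub> basis_comb (complex_space (terwilliger q D) L) n v c =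
    basis_comb (complex_space (terwilliger q D) L) n v (\<lambda>i. \<Sum>j<n. B i j * c j)"
proof -
  let ?W = "complex_space (terwilliger q D) L"
  interpret left_module "terwilliger q D" L by fact
  interpret W: vectorspace class_ring ?W by (rule vectorspace_complex_space[OF L])
  have v: "\<And>i. i < n \<Longrightarrow> v i \<in> carrier L" and vW: "v \<in> {..<n} \<rightarrow> carrier ?W" using V by auto
  note lin = basis_comb_linear[OF W.vectorspace_axioms vW]
  have zero: "basis_comb ?W n v (\<lambda>i. 0) = \<zero>\<^bsub>L\<^esub>"
    using lin(3)[of 0 "\<lambda>i. 0"] lin(1) W.lmult_0 by (simp add: class_ring_simps)
  have aj: "a \<odot>\<^bsub>L\<^esub> v j = basis_comb ?W n v (\<lambda>i. B i j)" if "j < n" for j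
    using act that by (simp add: acts_by_def basis_comb_def finsum_complex_space)
  \<comment> \<open>Induction on the number of terms included: the right-hand side has the first
    \<open>m\<close> columns of \<open>B\<close> but all \<open>n\<close> rows.\<close>
  have "a \<odot>\<^bsub>L\<^esub> finsum L (\<lambda>j. scalar q D (c j) \<odot>\<^bsub>L\<^esub> v j) {..<m} =
      basis_comb ?W n v (\<lambda>i. \<Sum>j<m. B i j * c j)" if "m \<le> n" for m
    using that
  proof (induction m)
    case 0
    then show ?case using zero smult_zero_right[OF L a] by (simp add: M.finsum_empty)
  next
    case (Suc m)
    have cl: "scalar q D (c j) \<odot>\<^bsub>L\<^esub> v j \<in> carrier L" if "j \<le> m" for j
      using that Suc.prems v scalar_in_terwilliger by (intro smult_closed) auto
    then have fin: "finsum L (\<lambda>j. scalar q D (c j) \<odot>\<^bsub>L\<^esub> v j) {..<m} \<in> carrier L"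
      by (intro M.finsum_closed) auto
    have "a \<odot>\<^bsub>L\<^esub> finsum L (\<lambda>j. scalar q D (c j) \<odot>\<^bsub>L\<^esub> v j) {..<Suc m} =
        a \<odot>\<^bsub>L\<^esub> (scalar q D (c m) \<odot>\<^bsub>L\<^esub> v m \<oplus>\<^bsub>L\<^esub> finsum L (\<lambda>j. scalar q D (c j) \<odot>\<^bsub>L\<^esub> v j) {..<m})"
      unfolding lessThan_Suc using cl by (subst M.finsum_insert) auto
    also have "\<dots> = scalar q D (c m) \<odot>\<^bsub>L\<^esub> (a \<odot>\<^bsub>L\<^esub> v m) \<oplus>\<^bsub>L\<^esub> basis_comb ?W n v (\<lambda>i. \<Sum>j<m. B i j * c j)"
      using Suc cl[of m] fin v[of m] by (simp only: smult_r_distr[OF a] scalar_commute[OF L a] Suc_le_eq less_imp_le order_refl)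
    also have "scalar q D (c m) \<odot>\<^bsub>L\<^esub> (a \<odot>\<^bsub>L\<^esub> v m) = basis_comb ?W n v (\<lambda>i. c m * B i m)"
      using Suc.prems unfolding lin(3) by (simp only: aj complex_space_simps Suc_le_eq)
    also have "basis_comb ?W n v (\<lambda>i. c m * B i m) \<oplus>\<^bsub>L\<^esub> basis_comb ?W n v (\<lambda>i. \<Sum>j<m. B i j * c j) =
        basis_comb ?W n v (\<lambda>i. \<Sum>j<Suc m. B i j * c j)"
      using lin(2)[of "\<lambda>i. c m * B i m" "\<lambda>i. \<Sum>j<m. B i j * c j"] by (simp add: mult.commute add.commute)
    finally show ?case .
  qed
  from this[of n] show ?thesis
    unfolding basis_comb_def[of ?W n v c] finsum_complex_space by simp
qed

text \<open>Directed from sequences to the module, which avoids choosing an inverse. The map is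
  defined on total sequences and, by the third clause, ignores the entries beyond
  \<open>p - 2 * k\<close>.\<close>

definition L_coordinates ::
    "nat \<Rightarrow> nat \<Rightarrow> nat \<Rightarrow> nat \<Rightarrow> (nat list sqmat, 'b) module \<Rightarrow> ((nat \<Rightarrow> complex) \<Rightarrow> 'b) \<Rightarrow> bool" where
  "L_coordinates q D p k L \<phi> \<longleftrightarrow>
     (\<forall>c. \<phi> c \<in> carrier L) \<and>
     (\<forall>x\<in>carrier L. \<exists>c. \<phi> c = x) \<and>
     (\<forall>c d. \<phi> c = \<phi> d \<longleftrightarrow> (\<forall>i<p - 2 * k + 1. c i = d i)) \<and>
     (\<forall>c d. \<phi> (\<lambda>i. c i + d i) = \<phi> c \<oplus>\<^bsub>L\<^esub> \<phi> d) \<and>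
     (\<forall>s c. \<phi> (\<lambda>i. s * c i) = scalar q D s \<odot>\<^bsub>L\<^esub> \<phi> c) \<and>
     (\<forall>c. \<phi> (\<lambda>i. \<Sum>j<p - 2 * k + 1. tridiag_L q D p k i j * c j) = adjacency_matrix q D \<odot>\<^bsub>L\<^esub> \<phi> c) \<and>
     (\<forall>c. \<phi> (\<lambda>i. \<Sum>j<p - 2 * k + 1. diag_L q D p k i j * c j) = dual_adjacency_matrix q D \<odot>\<^bsub>L\<^esub> \<phi> c)"

lemma is_L_coordinates:
  assumes "is_L q D p k L"
  shows "\<exists>\<phi>. L_coordinates q D p k L \<phi>"
proof -
  let ?W = "complex_space (terwilliger q D) L" and ?n = "p - 2 * k + 1"
  have L: "left_module (terwilliger q D) L"
    using assms by (simp add: is_L_def irreducible_module_def)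
  obtain v where b: "ordered_basis ?W ?n v"
    and A: "acts_by (terwilliger q D) L ?n v (adjacency_matrix q D) (tridiag_L q D p k)"
    and A': "acts_by (terwilliger q D) L ?n v (dual_adjacency_matrix q D) (diag_L q D p k)"
    using assms unfolding is_L_def by blast
  interpret W: vectorspace class_ring ?W by (rule vectorspace_complex_space[OF L])
  have vW: "v \<in> {..<?n} \<rightarrow> carrier ?W"
    using b by (auto simp: ordered_basis_def W.basis_def)
  then have v: "v \<in> {..<?n} \<rightarrow> carrier L" by simp
  note lin = basis_comb_linear[OF W.vectorspace_axioms vW]
  note bij = b[unfolded ordered_basis_iff[OF W.vectorspace_axioms vW]]
  have "L_coordinates q D p k L (basis_comb ?W ?n v)"
    unfolding L_coordinates_def
  proof (intro conjI allI ballI)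
    fix c d :: "nat \<Rightarrow> complex"
    show "basis_comb ?W ?n v c \<in> carrier L" using lin(1) by simp
    show "basis_comb ?W ?n v c = basis_comb ?W ?n v d \<longleftrightarrow> (\<forall>i<?n. c i = d i)"
      using bij lin(4)[of c d] by blast
  qed (use bij lin(2,3) acts_by_basis_comb[OF L v adjacency_in_terwilliger A]
       acts_by_basis_comb[OF L v dual_adjacency_in_terwilliger A'] in auto)
  then show ?thesis by (intro exI)
qed

section \<open>Coordinates on the standard module\<close>

text \<open>Only the values on \<open>string_index q D\<close> are determined; elsewhere the choice
  is arbitrary.\<close>

definition coord :: "nat \<Rightarrow> nat \<Rightarrow> (nat list \<Rightarrow> complex) \<Rightarrow> nat \<times> nat \<times> nat \<times> nat \<Rightarrow> complex" where
  "coord q D f = (SOME c. \<forall>x. f x = (\<Sum>s\<in>string_index q D. c s * string_basis q D s x))"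

lemma carrier_standard: "carrier (standard_module q D) = {f. \<forall>x. x \<notin> vertices q D \<longrightarrow> f x = 0}"
  and add_standard: "f \<oplus>\<^bsub>standard_module q D\<^esub> g = (\<lambda>x. f x + g x)"
  and zero_standard: "\<zero>\<^bsub>standard_module q D\<^esub> = (\<lambda>x. 0)"
  by (simp_all add: standard_module_def column_space_def)

lemma scalar_standard:
  assumes "f \<in> carrier (standard_module q D)"
  shows "mat_vec q D (scalar q D c) f = (\<lambda>x. c * f x)"
proof
  fix x
  have "mat_vec q D (scalar q D c) f x = (\<Sum>y\<in>vertices q D. if y = x then c * f x else 0)"
    unfolding mat_vec_apply scalar_eq
    by (rule sum.cong) (use assms in \<open>auto simp: carrier_standard\<close>)
  then show "mat_vec q D (scalar q D c) f x = c * f x"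
    using assms by (auto simp: finite_vertices carrier_standard)
qed

context
  fixes q D :: nat
  assumes q: "q \<ge> 3"
begin

lemma coord_sum:
  assumes "f \<in> carrier (standard_module q D)"
  shows "f x = (\<Sum>s\<in>string_index q D. coord q D f s * string_basis q D s x)"
proof -
  have "\<exists>c. \<forall>x. f x = (\<Sum>s\<in>string_index q D. c s * string_basis q D s x)"
    using assms by (intro string_basis_coordinates[OF q]) (auto simp: carrier_standard)
  from someI_ex[OF this] show ?thesis unfolding coord_def by blast
qed

lemma string_basis_outside:
  assumes "s \<in> string_index q D" "x \<notin> vertices q D"
  shows "string_basis q D s x = 0"
  using funs.span_base[of "string_basis q D s" "string_basis q D ` string_index q D"] assms
  unfolding string_basis_is_basis(3)[OF q] by blast

lemma string_comb_in_standard: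
  "(\<lambda>x. \<Sum>s\<in>string_index q D. c s * string_basis q D s x) \<in> carrier (standard_module q D)"
  by (auto simp: carrier_standard string_basis_outside intro!: sum.neutral)

lemma coord_unique:
  assumes "\<And>x. f x = (\<Sum>s\<in>string_index q D. c s * string_basis q D s x)" "s \<in> string_index q D"
  shows "coord q D f s = c s"
proof -
  have f: "f \<in> carrier (standard_module q D)"
    using string_comb_in_standard[of c] assms(1) by presburger
  have "(\<Sum>s\<in>string_index q D. (coord q D f s - c s) * string_basis q D s x) = 0" for x
    using coord_sum[OF f, of x] assms(1)[of x] by (simp add: left_diff_distrib sum_subtractf)
  from string_basis_unique[OF q this assms(2)] show ?thesis by simp
qed

lemma is_string_at:
  assumes "(p, k, j, i) \<in> string_index q D"
  shows "is_string q D p k (string_at q D p k j)"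
  using assms
  by (intro is_string_strings[OF q] string_at_in_strings) (auto simp: string_index_def string_count_eq_multiplicity)

lemma tridiag_sum:
  assumes "j < n"
  shows "(\<Sum>i<n. tridiag_L q D p k i j * g i) =
    alpha q D p k j * g j + (if Suc j < n then beta j * g (Suc j) else 0)
    + (if j = 0 then 0 else gamma q p k j * g (j - 1))"
proof -
  \<comment> \<open>For \<open>j = 0\<close> the position \<open>j - 1\<close> coincides with
    \<open>j\<close>, hence the inner case distinction that removes the third term.\<close>
  have "(\<Sum>i<n. tridiag_L q D p k i j * g i) =
    (\<Sum>i<n. (if i = j then alpha q D p k j * g j else 0) +
      ((if i = Suc j then beta j * g (Suc j) else 0) +
       (if i = j - 1 then (if j = 0 then 0 else gamma q p k j * g (j - 1)) else 0)))"
    by (rule sum.cong) (auto simp: tridiag_L_def)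
  then show ?thesis using assms by (simp add: sum.distrib)
qed

text \<open>At the last position the \<open>beta\<close> term of the string relation disappears
  because the next vector is zero, so the finite matrix suffices.\<close>

lemma adjacency_string_basis:
  assumes "(p, k, j, i) \<in> string_index q D"
  shows "mat_vec q D (adjacency_matrix q D) (string_basis q D (p, k, j, i)) x =
    (\<Sum>l<p - 2 * k + 1. tridiag_L q D p k l i * string_basis q D (p, k, j, l) x)"
proof -
  have "i < p - 2 * k + 1" using assms by (simp add: string_index_def)
  with string_facts(4,5)[OF is_string_at[OF assms] q] show ?thesis
    by (subst tridiag_sum) auto
qed

lemma dual_adjacency_string_basis:
  assumes "(p, k, j, i) \<in> string_index q D"
  shows "mat_vec q D (dual_adjacency_matrix q D) (string_basis q D (p, k, j, i)) x =
    (\<Sum>l<p - 2 * k + 1. diag_L q D p k l i * string_basis q D (p, k, j, l) x)"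
proof -
  have "i < p - 2 * k + 1" using assms by (simp add: string_index_def)
  with string_facts(6)[OF is_string_at[OF assms] q] show ?thesis
    by (simp add: diag_L_def if_distrib[of "\<lambda>c. c * _"] cong: if_cong)
qed

lemma sum_string_index:
  fixes h :: "_ \<Rightarrow> 'a::comm_monoid_add"
  shows "(\<Sum>s\<in>string_index q D. h s) =
    (\<Sum>p\<le>D. \<Sum>k\<le>p div 2. \<Sum>j<multiplicity_L q D p k. \<Sum>i<p - 2 * k + 1. h (p, k, j, i))"
proof -
  have Sigma: "(\<Sum>z\<in>Sigma A B. g z) = (\<Sum>x\<in>A. \<Sum>y\<in>B x. g (x, y))"
    if "finite A" "\<And>x. finite (B x)" for A :: "'x set" and B :: "'x \<Rightarrow> 'y set" and g :: "'x \<times> 'y \<Rightarrow> 'a"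
    using that by (simp add: sum.Sigma)
  show ?thesis by (simp add: string_index_def Sigma)
qed

text \<open>Each block \<open>(p, k, j)\<close> is invariant; the columns of \<open>B\<close> expand
  the images of its basis vectors, so coordinates are transformed by the rows.\<close>

lemma coord_mat_vec:
  assumes f: "f \<in> carrier (standard_module q D)"
    and A: "\<And>p k j i x. (p, k, j, i) \<in> string_index q D \<Longrightarrow>
      mat_vec q D A (string_basis q D (p, k, j, i)) x =
      (\<Sum>l<p - 2 * k + 1. B p k l i * string_basis q D (p, k, j, l) x)"
    and s: "(p, k, j, i) \<in> string_index q D"
  shows "coord q D (mat_vec q D A f) (p, k, j, i) = (\<Sum>l<p - 2 * k + 1. B p k i l * coord q D f (p, k, j, l))"
proof -
  let ?c = "coord q D f" and ?b = "string_basis q D"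
  have "coord q D (mat_vec q D A f) (p, k, j, i) =
    (\<lambda>(p, k, j, i). \<Sum>l<p - 2 * k + 1. B p k i l * ?c (p, k, j, l)) (p, k, j, i)"
  proof (rule coord_unique[OF _ s])
    fix x
    have "mat_vec q D A f x = (\<Sum>y\<in>vertices q D. \<Sum>s\<in>string_index q D. A x y * (?c s * ?b s y))"
      unfolding mat_vec_apply by (rule sum.cong[OF refl], subst coord_sum[OF f]) (simp add: sum_distrib_left)
    also have "\<dots> = (\<Sum>s\<in>string_index q D. ?c s * mat_vec q D A (?b s) x)"
      unfolding mat_vec_apply by (subst sum.swap) (simp add: sum_distrib_left mult_ac)
    also have "\<dots> = (\<Sum>s\<in>string_index q D. (\<lambda>(p, k, j, i). ?c (p, k, j, i) *
        (\<Sum>l<p - 2 * k + 1. B p k l i * ?b (p, k, j, l) x)) s)"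
      by (rule sum.cong[OF refl]) (auto simp: A simp del: string_basis.simps)
    also have "\<dots> = (\<Sum>p\<le>D. \<Sum>k\<le>p div 2. \<Sum>j<multiplicity_L q D p k. \<Sum>i<p - 2 * k + 1.
        \<Sum>l<p - 2 * k + 1. ?c (p, k, j, i) * (B p k l i * ?b (p, k, j, l) x))"
      unfolding sum_string_index by (simp only: prod.case sum_distrib_left)
    also have "\<dots> = (\<Sum>p\<le>D. \<Sum>k\<le>p div 2. \<Sum>j<multiplicity_L q D p k. \<Sum>l<p - 2 * k + 1.
        (\<Sum>i<p - 2 * k + 1. B p k l i * ?c (p, k, j, i)) * ?b (p, k, j, l) x)"
      by (rule sum.cong[OF refl], rule sum.cong[OF refl], rule sum.cong[OF refl], subst sum.swap)
         (simp only: sum_distrib_right, simp only: mult_ac)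
    also have "\<dots> = (\<Sum>s\<in>string_index q D. (\<lambda>(p, k, j, i). \<Sum>l<p - 2 * k + 1. B p k i l * ?c (p, k, j, l)) s * ?b s x)"
      unfolding sum_string_index by (simp only: prod.case)
    finally show "mat_vec q D A f x = \<dots>" .
  qed
  then show ?thesis by simp
qed

lemma coord_add:
  assumes "f \<in> carrier (standard_module q D)" "g \<in> carrier (standard_module q D)" "s \<in> string_index q D"
  shows "coord q D (\<lambda>x. f x + g x) s = coord q D f s + coord q D g s"
proof (rule coord_unique[OF _ assms(3)])
  show "f x + g x = (\<Sum>s\<in>string_index q D. (coord q D f s + coord q D g s) * string_basis q D s x)" for x
    unfolding distrib_right sum.distrib
    by (rule arg_cong2[OF coord_sum[OF assms(1)] coord_sum[OF assms(2)]])
qed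

lemma coord_scale:
  assumes "f \<in> carrier (standard_module q D)" "s \<in> string_index q D"
  shows "coord q D (\<lambda>x. c * f x) s = c * coord q D f s"
proof (rule coord_unique[OF _ assms(2)])
  show "c * f x = (\<Sum>s\<in>string_index q D. (c * coord q D f s) * string_basis q D s x)" for x
    unfolding mult.assoc sum_distrib_left[symmetric]
    by (rule arg_cong[OF coord_sum[OF assms(1)]])
qed

end

section \<open>The decomposition\<close>

lemma direct_sum_module_simps:
  "finite I \<Longrightarrow> carrier (direct_sum_module I M) = (\<Pi>\<^sub>E i\<in>I. carrier (M i))"
  "f \<oplus>\<^bsub>direct_sum_module I M\<^esub> g = (\<lambda>i\<in>I. f i \<oplus>\<^bsub>M i\<^esub> g i)"
  "a \<odot>\<^bsub>direct_sum_module I M\<^esub> f = (\<lambda>i\<in>I. a \<odot>\<^bsub>M i\<^esub> f i)"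
  by (simp_all add: direct_sum_module_def)

definition L_sum ::
    "nat \<Rightarrow> nat \<Rightarrow> (nat \<Rightarrow> nat \<Rightarrow> (nat list sqmat, 'b) module) \<Rightarrow>
      (nat list sqmat, nat \<Rightarrow> nat \<Rightarrow> nat \<Rightarrow> 'b) module" where
  "L_sum q D L = direct_sum_module {0..D} (\<lambda>p. direct_sum_module {0..p div 2} (\<lambda>k.
     copies (multiplicity_L q D p k) (L p k)))"

lemmas L_sum_simps = L_sum_def copies_def direct_sum_module_simps

lemma L_sum_carrierI:
  assumes "\<And>p k j. \<lbrakk>p \<le> D; k \<le> p div 2; j < multiplicity_L q D p k\<rbrakk> \<Longrightarrow> y p k j \<in> carrier (L p k)"
  shows "(\<lambda>p\<in>{0..D}. \<lambda>k\<in>{0..p div 2}. \<lambda>j\<in>{..<multiplicity_L q D p k}. y p k j) \<in> carrier (L_sum q D L)"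
  unfolding L_sum_simps(1,2) using assms by (auto simp: direct_sum_module_simps)

text \<open>Elements are extensional at all three levels of the direct sum, so the components at
  admissible indices recover them.\<close>

lemma L_sum_carrierD:
  assumes "y \<in> carrier (L_sum q D L)"
  shows "\<lbrakk>p \<le> D; k \<le> p div 2; j < multiplicity_L q D p k\<rbrakk> \<Longrightarrow> y p k j \<in> carrier (L p k)"
    and "y = (\<lambda>p\<in>{0..D}. \<lambda>k\<in>{0..p div 2}. \<lambda>j\<in>{..<multiplicity_L q D p k}. y p k j)"
proof -
  have y: "y \<in> (\<Pi>\<^sub>E p\<in>{0..D}. \<Pi>\<^sub>E k\<in>{0..p div 2}. \<Pi>\<^sub>E j\<in>{..<multiplicity_L q D p k}. carrier (L p k))"
    using assms by (simp add: L_sum_simps)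
  have yp: "y p \<in> (\<Pi>\<^sub>E k\<in>{0..p div 2}. \<Pi>\<^sub>E j\<in>{..<multiplicity_L q D p k}. carrier (L p k))" if "p \<le> D" for p
    using PiE_mem[OF y, of p] that by simp
  have yk: "y p k \<in> (\<Pi>\<^sub>E j\<in>{..<multiplicity_L q D p k}. carrier (L p k))" if "p \<le> D" "k \<le> p div 2" for p k
    using PiE_mem[OF yp, of p k] that by simp
  show "y p k j \<in> carrier (L p k)" if "p \<le> D" "k \<le> p div 2" "j < multiplicity_L q D p k"
    using PiE_mem[OF yk, of p k j] that by simp
  show "y = (\<lambda>p\<in>{0..D}. \<lambda>k\<in>{0..p div 2}. \<lambda>j\<in>{..<multiplicity_L q D p k}. y p k j)"
  proof (intro ext)
    fix p k j
    show "y p k j = (\<lambda>p\<in>{0..D}. \<lambda>k\<in>{0..p div 2}. \<lambda>j\<in>{..<multiplicity_L q D p k}. y p k j) p k j"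
      using PiE_arb[OF y, of p] PiE_arb[OF yp, of p k] PiE_arb[OF yk, of p k j]
      by (auto simp: restrict_def)
  qed
qed

text \<open>\<open>F\<close> carries the coordinates in block \<open>(p, k, j)\<close> over to copy
  j of \<open>L p k\<close>. It is equivariant because the generators have the same matrices in both
  sets of coordinates.\<close>

lemma standard_module_isomorphic_L_sum:
  fixes L :: "nat \<Rightarrow> nat \<Rightarrow> (nat list sqmat, 'b) module"
  assumes q: "q \<ge> 3" and L: "\<And>p k. \<lbrakk>p \<le> D; k \<le> p div 2\<rbrakk> \<Longrightarrow> is_L q D p k (L p k)"
  shows "module_isomorphic (terwilliger q D) (standard_module q D) (L_sum q D L)"
proof -
  let ?V = "standard_module q D" and ?N = "L_sum q D L" and ?T = "terwilliger q D"
  have "\<exists>\<phi>. p \<le> D \<and> k \<le> p div 2 \<longrightarrow> L_coordinates q D p k (L p k) \<phi>" for p k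
    using is_L_coordinates[OF L, of p k] by blast
  then obtain \<phi> where "\<And>p k. p \<le> D \<and> k \<le> p div 2 \<longrightarrow> L_coordinates q D p k (L p k) (\<phi> p k)"
    by metis
  then have \<phi>: "L_coordinates q D p k (L p k) (\<phi> p k)" if "p \<le> D" "k \<le> p div 2" for p k
    using that by blast
  note facts = \<phi>[unfolded L_coordinates_def]
  have lm: "left_module ?T (L p k)" if "p \<le> D" "k \<le> p div 2" for p k
    using L[OF that] by (simp add: is_L_def irreducible_module_def)
  have N: "left_module ?T ?N"
    unfolding L_sum_def copies_def
    by (intro left_module_direct_sum_module ring_terwilliger lm) auto
  have index: "(p, k, j, i) \<in> string_index q D \<longleftrightarrow>
      p \<le> D \<and> k \<le> p div 2 \<and> j < multiplicity_L q D p k \<and> i < p - 2 * k + 1" for p k j i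
    by (auto simp: string_index_def)
  define F where "F f = (\<lambda>p\<in>{0..D}. \<lambda>k\<in>{0..p div 2}. \<lambda>j\<in>{..<multiplicity_L q D p k}.
    \<phi> p k (\<lambda>i. coord q D f (p, k, j, i)))" for f
  have Fc: "F f \<in> carrier ?N" for f
    unfolding F_def by (rule L_sum_carrierI) (use facts in blast)
  \<comment> \<open>\<open>coord\<close> is controlled only below \<open>p - 2 * k + 1\<close>, but
    \<open>\<phi> p k\<close> disregards the later entries.\<close>
  have F_cong: "F f = (\<lambda>p\<in>{0..D}. \<lambda>k\<in>{0..p div 2}. \<lambda>j\<in>{..<multiplicity_L q D p k}. \<phi> p k (c p k j))"
    if "\<And>p k j i. (p, k, j, i) \<in> string_index q D \<Longrightarrow> coord q D f (p, k, j, i) = c p k j i" for f c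
    unfolding F_def
  proof (intro restrict_ext)
    fix p k j assume pkj: "p \<in> {0..D}" "k \<in> {0..p div 2}" "j \<in> {..<multiplicity_L q D p k}"
    then show "\<phi> p k (\<lambda>i. coord q D f (p, k, j, i)) = \<phi> p k (c p k j)"
      using that facts[of p k] by (simp add: index)
  qed
  have F_add: "F (f \<oplus>\<^bsub>?V\<^esub> g) = F f \<oplus>\<^bsub>?N\<^esub> F g" if "f \<in> carrier ?V" "g \<in> carrier ?V" for f g
  proof -
    have "F (f \<oplus>\<^bsub>?V\<^esub> g) = (\<lambda>p\<in>{0..D}. \<lambda>k\<in>{0..p div 2}. \<lambda>j\<in>{..<multiplicity_L q D p k}.
        \<phi> p k (\<lambda>i. coord q D f (p, k, j, i) + coord q D g (p, k, j, i)))"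
      using coord_add[OF q that] by (intro F_cong) (simp add: add_standard)
    also have "\<dots> = F f \<oplus>\<^bsub>?N\<^esub> F g"
      unfolding F_def L_sum_simps using facts by (intro restrict_ext) simp
    finally show ?thesis .
  qed
  \<comment> \<open>\<open>B\<close> is the operator on coordinates that \<open>a\<close> induces on
    both sides: a matrix for each generator, a multiple for a scalar.\<close>
  have F_smult: "F (a \<odot>\<^bsub>?V\<^esub> f) = a \<odot>\<^bsub>?N\<^esub> F f"
    if "\<And>p k j i. (p, k, j, i) \<in> string_index q D \<Longrightarrow>
        coord q D (a \<odot>\<^bsub>?V\<^esub> f) (p, k, j, i) = B p k (\<lambda>i. coord q D f (p, k, j, i)) i"
      and "\<And>p k c. \<lbrakk>p \<le> D; k \<le> p div 2\<rbrakk> \<Longrightarrow> \<phi> p k (B p k c) = a \<odot>\<^bsub>L p k\<^esub> \<phi> p k c" for a f B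
  proof -
    have "F (a \<odot>\<^bsub>?V\<^esub> f) = (\<lambda>p\<in>{0..D}. \<lambda>k\<in>{0..p div 2}. \<lambda>j\<in>{..<multiplicity_L q D p k}.
        \<phi> p k (B p k (\<lambda>i. coord q D f (p, k, j, i))))"
      by (rule F_cong) (rule that(1))
    also have "\<dots> = a \<odot>\<^bsub>?N\<^esub> F f"
      unfolding F_def L_sum_simps using that(2) by (intro restrict_ext) simp
    finally show ?thesis .
  qed
  have equi: "F (a \<odot>\<^bsub>?V\<^esub> f) = a \<odot>\<^bsub>?N\<^esub> F f" if "a \<in> carrier ?T" "f \<in> carrier ?V" for a f
  proof (rule equivariantI[OF left_module_standard N Fc F_add _ _ _ that])
    fix f assume f: "f \<in> carrier ?V"
    show "F (adjacency_matrix q D \<odot>\<^bsub>?V\<^esub> f) = adjacency_matrix q D \<odot>\<^bsub>?N\<^esub> F f"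
      using facts
      by (intro F_smult[where B = "\<lambda>p k c i. \<Sum>l<p - 2 * k + 1. tridiag_L q D p k i l * c l"]
          coord_mat_vec[OF q f adjacency_string_basis[OF q]]) blast+
    show "F (dual_adjacency_matrix q D \<odot>\<^bsub>?V\<^esub> f) = dual_adjacency_matrix q D \<odot>\<^bsub>?N\<^esub> F f"
      using facts
      by (intro F_smult[where B = "\<lambda>p k c i. \<Sum>l<p - 2 * k + 1. diag_L q D p k i l * c l"]
          coord_mat_vec[OF q f dual_adjacency_string_basis[OF q]]) blast+
    show "F (scalar q D s \<odot>\<^bsub>?V\<^esub> f) = scalar q D s \<odot>\<^bsub>?N\<^esub> F f" for s
      unfolding scalar_standard[OF f]
      by (rule F_smult[where a = "scalar q D s" and f = f and B = "\<lambda>p k c i. s * c i", unfolded scalar_standard[OF f]])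
        (use facts coord_scale[OF q f] in blast)+
  qed
  have inj: "inj_on F (carrier ?V)"
  proof (rule inj_onI)
    fix f g assume fg: "f \<in> carrier ?V" "g \<in> carrier ?V" "F f = F g"
    have "coord q D f s = coord q D g s" if s: "s \<in> string_index q D" for s
    proof -
      obtain p k j i where [simp]: "s = (p, k, j, i)" by (metis prod.collapse)
      have s': "p \<le> D" "k \<le> p div 2" "j < multiplicity_L q D p k" "i < p - 2 * k + 1"
        using s by (auto simp: index)
      have "F f p k j = F g p k j" using fg(3) by simp
      then have "\<phi> p k (\<lambda>i. coord q D f (p, k, j, i)) = \<phi> p k (\<lambda>i. coord q D g (p, k, j, i))"
        using s' by (simp add: F_def)
      then show ?thesis using facts[OF s'(1,2)] s'(4) by simp
    qed
    then show "f = g"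
      by (intro ext, subst coord_sum[OF q fg(1)], subst coord_sum[OF q fg(2)]) simp
  qed
  have surj: "y \<in> F ` carrier ?V" if y: "y \<in> carrier ?N" for y
  proof -
    have "\<exists>c. p \<le> D \<and> k \<le> p div 2 \<and> j < multiplicity_L q D p k \<longrightarrow> \<phi> p k c = y p k j" for p k j
      using L_sum_carrierD(1)[OF y, of p k j] facts[of p k] by blast
    then obtain c where c: "\<And>p k j. p \<le> D \<and> k \<le> p div 2 \<and> j < multiplicity_L q D p k \<longrightarrow> \<phi> p k (c p k j) = y p k j"
      by metis
    define f where "f x = (\<Sum>s\<in>string_index q D. (\<lambda>(p, k, j, i). c p k j i) s * string_basis q D s x)" for x
    have f: "f \<in> carrier ?V"
      unfolding f_def[abs_def] by (rule string_comb_in_standard[OF q])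
    have "F f = (\<lambda>p\<in>{0..D}. \<lambda>k\<in>{0..p div 2}. \<lambda>j\<in>{..<multiplicity_L q D p k}. \<phi> p k (c p k j))"
      using coord_unique[OF q f_def] by (intro F_cong) simp
    also have "\<dots> = (\<lambda>p\<in>{0..D}. \<lambda>k\<in>{0..p div 2}. \<lambda>j\<in>{..<multiplicity_L q D p k}. y p k j)"
      using c by (intro restrict_ext) simp
    also have "\<dots> = y" by (rule L_sum_carrierD(2)[OF y, symmetric])
    finally show ?thesis using f by blast
  qed
  have "F \<in> iso (add_monoid ?V) (add_monoid ?N)"
    unfolding iso_def hom_def bij_betw_def using Fc F_add inj surj by auto
  then show ?thesis
    unfolding module_isomorphic_def using equi by blast
qed

lemma standard_smult_simps:
  assumes "f \<in> carrier (standard_module q D)"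
  shows "a \<in> carrier (terwilliger q D) \<Longrightarrow> b \<in> carrier (terwilliger q D) \<Longrightarrow>
      mat_vec q D (a \<oplus>\<^bsub>terwilliger q D\<^esub> b) f = mat_vec q D a f \<oplus>\<^bsub>standard_module q D\<^esub> mat_vec q D b f"
    and "a \<in> carrier (terwilliger q D) \<Longrightarrow> b \<in> carrier (terwilliger q D) \<Longrightarrow>
      mat_vec q D (a \<otimes>\<^bsub>terwilliger q D\<^esub> b) f = mat_vec q D a (mat_vec q D b f)"
  using left_module.smult_l_distr[OF left_module_standard _ _ assms]
    left_module.smult_assoc[OF left_module_standard _ _ assms] by blast+

section \<open>Irreducibility of the strings\<close>

text \<open>Invariance under the generators spreads by \<open>terwilliger_induct\<close>, and
  scaling by -1 supplies negatives.\<close>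

lemma left_module_invariant_subspace:
  assumes S: "S \<subseteq> carrier (standard_module q D)" and zero: "(\<lambda>x. 0) \<in> S"
    and add: "\<And>f g. f \<in> S \<Longrightarrow> g \<in> S \<Longrightarrow> (\<lambda>x. f x + g x) \<in> S"
    and scale: "\<And>f c. f \<in> S \<Longrightarrow> (\<lambda>x. c * f x) \<in> S"
    and gens: "\<And>f. f \<in> S \<Longrightarrow> mat_vec q D (adjacency_matrix q D) f \<in> S"
      "\<And>f. f \<in> S \<Longrightarrow> mat_vec q D (dual_adjacency_matrix q D) f \<in> S"
  shows "left_module (terwilliger q D) ((standard_module q D)\<lparr>carrier := S\<rparr>)"
proof -
  interpret V: left_module "terwilliger q D" "standard_module q D" by (rule left_module_standard)
  have closed: "mat_vec q D a f \<in> S" if "a \<in> carrier (terwilliger q D)" "f \<in> S" for a f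
    using that
  proof (induction arbitrary: f rule: terwilliger_induct)
    case (scalar c)
    have "f \<in> carrier (standard_module q D)" using S scalar by blast
    then show ?case using scale[OF scalar] by (simp only: scalar_standard)
  next
    case (add a b)
    have "f \<in> carrier (standard_module q D)" using S add by blast
    then show ?case using add assms(3) by (simp only: standard_smult_simps add_standard)
  next
    case (mult a b)
    have "f \<in> carrier (standard_module q D)" using S mult by blast
    then show ?case using mult by (simp only: standard_smult_simps)
  qed (use gens in auto)
  have "abelian_group ((standard_module q D)\<lparr>carrier := S\<rparr>)"
  proof (rule abelian_groupI)
    fix f assume "f \<in> carrier ((standard_module q D)\<lparr>carrier := S\<rparr>)"
    then show "\<exists>g\<in>carrier ((standard_module q D)\<lparr>carrier := S\<rparr>).
        g \<oplus>\<^bsub>(standard_module q D)\<lparr>carrier := S\<rparr>\<^esub> f = \<zero>\<^bsub>(standard_module q D)\<lparr>carrier := S\<rparr>\<^esub>"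
      using scale[of f "-1"] by (intro bexI[of _ "\<lambda>x. -1 * f x"]) (auto simp: add_standard zero_standard)
  qed (use zero add in \<open>auto simp: add_standard zero_standard add_ac\<close>)
  moreover have "left_module_axioms (terwilliger q D) ((standard_module q D)\<lparr>carrier := S\<rparr>)"
    unfolding left_module_axioms_def
    using closed S V.smult_l_distr V.smult_r_distr V.smult_assoc V.smult_one by (simp add: subset_iff)
  ultimately show ?thesis
    using ring_terwilliger by (simp add: left_module_def)
qed

definition string_comb :: "nat \<Rightarrow> (nat \<Rightarrow> nat list \<Rightarrow> complex) \<Rightarrow> (nat \<Rightarrow> complex) \<Rightarrow> nat list \<Rightarrow> complex" where
  "string_comb n v c x = (\<Sum>i<n. c i * v i x)"

lemma mat_vec_string_comb: "mat_vec q D A (string_comb n v c) x = (\<Sum>i<n. c i * mat_vec q D A (v i) x)"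
  unfolding mat_vec_apply string_comb_def sum_distrib_left
  by (subst sum.swap) (simp add: mult_ac)

lemma mat_vec_string_comb_matrix:
  assumes "\<And>j x. j < n \<Longrightarrow> mat_vec q D A (v j) x = (\<Sum>i<n. B i j * v i x)"
  shows "mat_vec q D A (string_comb n v c) = string_comb n v (\<lambda>i. \<Sum>j<n. B i j * c j)"
proof
  fix x
  have "mat_vec q D A (string_comb n v c) x = (\<Sum>j<n. \<Sum>i<n. c j * (B i j * v i x))"
    by (simp add: mat_vec_string_comb assms sum_distrib_left)
  also have "\<dots> = string_comb n v (\<lambda>i. \<Sum>j<n. B i j * c j) x"
    unfolding string_comb_def sum_distrib_right by (subst sum.swap) (simp add: mult_ac)
  finally show "mat_vec q D A (string_comb n v c) x = string_comb n v (\<lambda>i. \<Sum>j<n. B i j * c j) x" .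
qed

lemma string_comb_unit: "i < n \<Longrightarrow> string_comb n v (\<lambda>l. if l = i then c else 0) = (\<lambda>x. c * v i x)"
  by (auto simp: string_comb_def if_distrib[of "\<lambda>c. c * _"] cong: if_cong)

lemma finsum_standard:
  fixes n :: nat
  assumes "abelian_group ((standard_module q D)\<lparr>carrier := S\<rparr>)" "\<And>i. i < n \<Longrightarrow> f i \<in> S"
  shows "finsum ((standard_module q D)\<lparr>carrier := S\<rparr>) f {..<n} = (\<lambda>x. \<Sum>i<n. f i x)"
  using assms(2)
proof (induction n)
  case 0
  interpret abelian_group "(standard_module q D)\<lparr>carrier := S\<rparr>" by fact
  show ?case by (simp add: finsum_empty zero_standard)
next
  case (Suc n)
  interpret abelian_group "(standard_module q D)\<lparr>carrier := S\<rparr>" by fact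
  show ?case
    unfolding lessThan_Suc using Suc
    by (subst finsum_insert) (auto simp: add_standard)
qed

context
  fixes q D p k N :: nat
  assumes q: "q \<ge> 3" and p: "p \<le> D" and k: "k \<le> p div 2" and N: "N = p - 2 * k + 1"
begin

text \<open>String number 0 exists for every admissible label by \<open>multiplicity_pos\<close>;
  its span is the existence witness.\<close>

abbreviation (input) "first_string \<equiv> string_at q D p k 0"
abbreviation (input) "string_module \<equiv> (standard_module q D)\<lparr>carrier := range (string_comb N first_string)\<rparr>"

lemma N_index: "i < N \<Longrightarrow> (p, k, 0, i) \<in> string_index q D"
  using p k multiplicity_pos[OF q p k] by (simp add: string_index_def N)

lemma first_string_adjacency: "i < N \<Longrightarrow> mat_vec q D (adjacency_matrix q D) (first_string i) x = (\<Sum>l<N. tridiag_L q D p k l i * first_string l x)"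
  using adjacency_string_basis[OF q N_index] by (simp add: N)

lemma first_string_dual_adjacency: "i < N \<Longrightarrow> mat_vec q D (dual_adjacency_matrix q D) (first_string i) x = (\<Sum>l<N. diag_L q D p k l i * first_string l x)"
  using dual_adjacency_string_basis[OF q N_index] by (simp add: N)

text \<open>A relation along one string is a relation in the full basis, with coefficient 0 off the
  block \<open>(p, k, 0)\<close>.\<close>

lemma string_comb_eqD:
  assumes "string_comb N first_string c = string_comb N first_string d" "i < N"
  shows "c i = d i"
proof -
  let ?u = "\<lambda>(p', k', j, i). if p' = p \<and> k' = k \<and> j = 0 then c i - d i else 0"
  have "(\<Sum>s\<in>string_index q D. ?u s * string_basis q D s x) = 0" for x
  proof -
    have "(\<Sum>s\<in>string_index q D. ?u s * string_basis q D s x) =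
        (\<Sum>s\<in>(\<lambda>i. (p, k, 0, i)) ` {..<N}. ?u s * string_basis q D s x)"
      by (rule sum.mono_neutral_right[OF finite_string_index])
        (use N_index in \<open>auto simp: string_index_def N\<close>)
    also have "\<dots> = (\<Sum>i<N. (c i - d i) * first_string i x)"
      by (subst sum.reindex) (auto simp: inj_on_def)
    also have "\<dots> = string_comb N first_string c x - string_comb N first_string d x"
      by (simp add: string_comb_def left_diff_distrib sum_subtractf)
    finally show ?thesis using assms(1) by simp
  qed
  from string_basis_unique[OF q this N_index[OF assms(2)]] show ?thesis by simp
qed

lemma theta_inj: "theta q D p k i = theta q D p k j \<Longrightarrow> i = j"
  using q by (simp add: theta_def)

lemma string_module_subset: "range (string_comb N first_string) \<subseteq> carrier (standard_module q D)"
  using string_facts(3)[OF is_string_at[OF q N_index] q]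
  by (auto simp: carrier_standard string_comb_def intro!: sum.neutral)

lemma string_comb_add: "(\<lambda>x. string_comb N first_string c x + string_comb N first_string d x) = string_comb N first_string (\<lambda>i. c i + d i)"
  and string_comb_scale: "(\<lambda>x. s * string_comb N first_string c x) = string_comb N first_string (\<lambda>i. s * c i)"
  by (auto simp: string_comb_def distrib_right sum.distrib sum_distrib_left mult.assoc)

lemma string_module_left_module: "left_module (terwilliger q D) string_module"
proof (rule left_module_invariant_subspace[OF string_module_subset])
  show "(\<lambda>x. 0) \<in> range (string_comb N first_string)"
    by (rule range_eqI[of _ _ "\<lambda>i. 0"]) (simp add: string_comb_def fun_eq_iff)
qed (auto simp: string_comb_add string_comb_scale
  mat_vec_string_comb_matrix[OF first_string_adjacency] mat_vec_string_comb_matrix[OF first_string_dual_adjacency])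

text \<open>Once \<open>S\<close> contains one basis vector, the nonzero entries \<open>beta\<close>
  and \<open>gamma\<close> beside the diagonal lead up and down the string to all the
  others.\<close>

lemma string_module_irreducible_aux:
  assumes S: "S \<subseteq> range (string_comb N first_string)"
    and add: "\<And>f g. f \<in> S \<Longrightarrow> g \<in> S \<Longrightarrow> (\<lambda>x. f x + g x) \<in> S"
    and scale: "\<And>f c. f \<in> S \<Longrightarrow> (\<lambda>x. c * f x) \<in> S"
    and gens: "\<And>f. f \<in> S \<Longrightarrow> mat_vec q D (adjacency_matrix q D) f \<in> S"
      "\<And>f. f \<in> S \<Longrightarrow> mat_vec q D (dual_adjacency_matrix q D) f \<in> S"
    and f: "f \<in> S" "f \<noteq> (\<lambda>x. 0)"
  shows "S = range (string_comb N first_string)"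
proof -
  text \<open>Since the eigenvalues of the dual adjacency matrix on the string are distinct, \<open>S\<close> contains
    each basis vector that occurs in one of its elements.\<close>
  have sep: "first_string i \<in> S" if "string_comb N first_string c \<in> S" "i < N" "c i \<noteq> 0" for c i
    using that
  proof (induction "card {j. j < N \<and> c j \<noteq> 0}" arbitrary: c rule: less_induct)
    case less
    show ?case
    proof (cases "\<exists>j<N. j \<noteq> i \<and> c j \<noteq> 0")
      case True
      then obtain j where j: "j < N" "j \<noteq> i" "c j \<noteq> 0" by blast
      \<comment> \<open>The dual adjacency matrix minus its eigenvalue at \<open>j\<close> removes
        \<open>j\<close> from the support and keeps \<open>i\<close>, so the support shrinks. The
        form as a sum fits \<open>string_comb_add\<close>.\<close>
      define d where "d l = theta q D p k l * c l + - theta q D p k j * c l" for l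
      have d: "d l = (theta q D p k l - theta q D p k j) * c l" for l
        by (simp add: d_def left_diff_distrib)
      have "mat_vec q D (dual_adjacency_matrix q D) (string_comb N first_string c) = string_comb N first_string (\<lambda>l. theta q D p k l * c l)"
        by (subst mat_vec_string_comb_matrix[OF first_string_dual_adjacency]) (auto simp: string_comb_def diag_L_def if_distrib[of "\<lambda>c. c * _"] cong: if_cong intro!: sum.cong)
      then have "string_comb N first_string (\<lambda>l. theta q D p k l * c l) \<in> S"
        using gens(2)[OF less.prems(1)] by simp
      moreover have "string_comb N first_string (\<lambda>l. - theta q D p k j * c l) \<in> S"
        using scale[OF less.prems(1)] by (simp only: string_comb_scale)
      ultimately have dS: "string_comb N first_string d \<in> S"
        unfolding d_def[abs_def] string_comb_add[symmetric] by (rule add)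
      have "{l. l < N \<and> d l \<noteq> 0} \<subset> {l. l < N \<and> c l \<noteq> 0}"
        using j by (auto simp: d)
      then have "card {l. l < N \<and> d l \<noteq> 0} < card {l. l < N \<and> c l \<noteq> 0}"
        by (intro psubset_card_mono) auto
      moreover have "d i \<noteq> 0"
        using j(2) less.prems(3) theta_inj by (auto simp: d)
      ultimately show ?thesis
        using less.hyps dS less.prems(2) by blast
    next
      case False
      then have "string_comb N first_string c = string_comb N first_string (\<lambda>l. if l = i then c i else 0)"
        by (intro ext, unfold string_comb_def, intro sum.cong) auto
      also have "\<dots> = (\<lambda>x. c i * first_string i x)" by (rule string_comb_unit[OF less.prems(2)])
      finally have "(\<lambda>x. 1 / c i * (c i * first_string i x)) \<in> S"
        using scale[OF less.prems(1), of "1 / c i"] by simp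
      then show ?thesis using less.prems(3) by simp
    qed
  qed
  have col: "string_comb N first_string (\<lambda>l. tridiag_L q D p k l i) \<in> S" if "first_string i \<in> S" "i < N" for i
  proof -
    have "mat_vec q D (adjacency_matrix q D) (first_string i) = string_comb N first_string (\<lambda>l. tridiag_L q D p k l i)"
      using first_string_adjacency[OF that(2)] by (auto simp: string_comb_def)
    then show ?thesis using gens(1)[OF that(1)] by simp
  qed
  have up: "first_string (Suc i) \<in> S" if "first_string i \<in> S" "Suc i < N" for i
  proof (rule sep[OF col[OF that(1)] that(2)])
    show "i < N" using that(2) by simp
    show "tridiag_L q D p k (Suc i) i \<noteq> 0"
      using of_nat_neq_0[of i, where ?'a = complex] by (simp add: tridiag_L_def beta_def add.commute)
  qed
  have down: "first_string i \<in> S" if "first_string (Suc i) \<in> S" "Suc i < N" for i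
  proof (rule sep[OF col[OF that]])
    \<comment> \<open>\<open>gamma\<close> vanishes one position past the end of the string;
      \<open>m\<close> is the distance from \<open>Suc i\<close> to the last position.\<close>
    have "Suc i + 2 * k \<le> p" using that(2) k N by linarith
    then obtain m where m: "p = Suc i + 2 * k + m" using le_Suc_ex by blast
    have "gamma q p k (Suc i) = (of_nat q - 1) * of_nat (Suc m)"
      unfolding gamma_def m by simp
    then have "gamma q p k (Suc i) \<noteq> 0"
      using q by (simp del: of_nat_Suc)
    then show "tridiag_L q D p k i (Suc i) \<noteq> 0" by (simp add: tridiag_L_def)
  qed (use that in auto)
  obtain c where c: "f = string_comb N first_string c" using S f(1) by blast
  have "\<exists>i<N. c i \<noteq> 0"
  proof (rule ccontr)
    assume "\<not> (\<exists>i<N. c i \<noteq> 0)"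
    then have "f = (\<lambda>x. 0)" by (simp add: c string_comb_def fun_eq_iff)
    with f(2) show False by simp
  qed
  then obtain i where i: "i < N" "c i \<noteq> 0" by blast
  have wi: "first_string i \<in> S" using sep[of c i] i f(1) c by simp
  have w0: "first_string 0 \<in> S"
    using wi i(1) by (induction i) (use down in auto)
  have wS: "first_string l \<in> S" if "l < N" for l
    using that by (induction l) (use w0 up in auto)
  have "string_comb m first_string c \<in> S" if "m \<le> N" for m c
    using that
  proof (induction m)
    case 0
    then show ?case using scale[OF f(1), of 0] by (simp add: string_comb_def[abs_def])
  next
    case (Suc m)
    then show ?case
      using add[OF Suc.IH scale[OF wS[of m], of "c m"]] by (simp add: string_comb_def[abs_def])
  qed
  then show ?thesis using S by blast
qed

lemma string_module_irreducible: "irreducible_module (terwilliger q D) string_module"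
  unfolding irreducible_module_def
proof (intro conjI allI impI string_module_left_module)
  have "string_comb N first_string (\<lambda>l. if l = 0 then 1 else 0) \<noteq> string_comb N first_string (\<lambda>l. 0)"
    using string_comb_eqD[of "\<lambda>l. if l = 0 then 1 else 0" "\<lambda>l. 0" 0] N by auto
  moreover have "string_comb N first_string (\<lambda>l. 0) = (\<lambda>x. 0)" by (simp add: string_comb_def fun_eq_iff)
  ultimately have ne: "range (string_comb N first_string) \<noteq> {\<lambda>x. 0}" by (metis rangeI singletonD)
  show "carrier string_module \<noteq> {\<zero>\<^bsub>string_module\<^esub>}" using ne by (simp add: zero_standard)
next
  fix S assume "Module.submodule S (terwilliger q D) string_module"
  then interpret S: Module.submodule S "terwilliger q D" string_module .
  have sub: "S \<subseteq> range (string_comb N first_string)" using S.subset by simp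
  \<comment> \<open>\<open>one_closed\<close>, and \<open>m_closed\<close> below, belong to the
    additive subgroup, so they speak of zero and of sums.\<close>
  have zero: "(\<lambda>x. 0) \<in> S" using S.one_closed by (simp add: zero_standard)
  have scale: "(\<lambda>x. c * f x) \<in> S" if "f \<in> S" for f c
  proof -
    have f: "f \<in> carrier (standard_module q D)" using sub string_module_subset that by blast
    have "mat_vec q D (scalar q D c) f \<in> S"
      using S.smult_closed[OF scalar_in_terwilliger that, of c] by simp
    then show ?thesis by (simp only: scalar_standard[OF f])
  qed
  show "S = {\<zero>\<^bsub>string_module\<^esub>} \<or> S = carrier string_module"
  proof (cases "S = {\<lambda>x. 0}")
    case False
    then obtain f where "f \<in> S" "f \<noteq> (\<lambda>x. 0)" using zero by blast
    then have "S = range (string_comb N first_string)"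
      using S.m_closed S.smult_closed[OF adjacency_in_terwilliger] S.smult_closed[OF dual_adjacency_in_terwilliger]
      by (intro string_module_irreducible_aux[OF sub _ scale]) (auto simp: add_standard)
    then show ?thesis by simp
  qed (simp add: zero_standard)
qed

lemma string_module_is_L: "is_L q D p k string_module"
proof -
  let ?W = "complex_space (terwilliger q D) string_module"
  interpret L: left_module "terwilliger q D" string_module by (rule string_module_left_module)
  interpret W: vectorspace class_ring ?W by (rule vectorspace_complex_space[OF string_module_left_module])
  have w_range: "first_string i \<in> range (string_comb N first_string)" if "i < N" for i
    by (rule range_eqI[of _ _ "\<lambda>l. if l = i then 1 else 0"]) (simp add: string_comb_unit[OF that])
  have smultW: "c \<odot>\<^bsub>?W\<^esub> first_string i = (\<lambda>x. c * first_string i x)" if "i < N" for c i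
  proof -
    have "first_string i \<in> carrier (standard_module q D)" using w_range[OF that] string_module_subset by blast
    from scalar_standard[OF this, of c] show ?thesis by simp
  qed
  have comb: "finsum string_module (\<lambda>i. c i \<odot>\<^bsub>?W\<^esub> first_string i) {..<N} = string_comb N first_string c" for c
  proof -
    have "finsum string_module (\<lambda>i. c i \<odot>\<^bsub>?W\<^esub> first_string i) {..<N} = (\<lambda>x. \<Sum>i<N. (c i \<odot>\<^bsub>?W\<^esub> first_string i) x)"
    proof (rule finsum_standard[OF L.M.abelian_group_axioms])
      fix i assume "i < N"
      then show "c i \<odot>\<^bsub>?W\<^esub> first_string i \<in> range (string_comb N first_string)"
        by (simp only: smultW string_comb_unit[symmetric] rangeI)
    qed
    also have "\<dots> = string_comb N first_string c"
      by (rule ext) (simp add: string_comb_def smultW del: complex_space_simps)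
    finally show ?thesis .
  qed
  have wW: "first_string \<in> {..<N} \<rightarrow> carrier ?W" using w_range by simp
  have basis_comb: "basis_comb ?W N first_string = string_comb N first_string"
    by (rule ext) (simp only: basis_comb_def finsum_complex_space comb)
  have ob: "ordered_basis ?W N first_string"
    unfolding ordered_basis_iff[OF W.vectorspace_axioms wW] basis_comb
    using string_comb_eqD by auto
  have "W.dim = card (first_string ` {..<N})"
    using ob by (intro W.dim_basis) (auto simp: ordered_basis_def)
  also have "\<dots> = N" using ob by (simp add: ordered_basis_def card_image)
  finally have dim: "W.dim = N" .
  have act: "acts_by (terwilliger q D) string_module N first_string A B"
    if "\<And>j x. j < N \<Longrightarrow> mat_vec q D A (first_string j) x = (\<Sum>i<N. B i j * first_string i x)" for A B
    unfolding acts_by_def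
  proof (intro allI impI)
    fix j assume "j < N"
    then have "A \<odot>\<^bsub>string_module\<^esub> first_string j = string_comb N first_string (\<lambda>i. B i j)"
      using that by (auto simp: string_comb_def)
    then show "A \<odot>\<^bsub>string_module\<^esub> first_string j = finsum string_module (\<lambda>i. B i j \<odot>\<^bsub>?W\<^esub> first_string i) {..<N}"
      by (simp only: comb)
  qed
  show ?thesis
    unfolding is_L_def N[symmetric]
    using string_module_irreducible dim ob act[OF first_string_adjacency] act[OF first_string_dual_adjacency] by blast
qed

end

text \<open>The existence half keeps the decomposition, which is claimed for every choice of the
  modules, from being vacuous: it provides models consisting of functions on words.\<close>

theorem theorem1p10:
  fixes q D :: nat
  assumes "q \<ge> 3" and "D \<ge> 1"
  shows "(\<forall>p\<le>D. \<forall>k\<le>p div 2.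
            \<exists>M :: (nat list sqmat, nat list \<Rightarrow> complex) module. is_L q D p k M) \<and>
         (\<forall>L :: nat \<Rightarrow> nat \<Rightarrow> (nat list sqmat, 'b) module.
            (\<forall>p\<le>D. \<forall>k\<le>p div 2. is_L q D p k (L p k)) \<longrightarrow>
            module_isomorphic (terwilliger q D) (standard_module q D)
              (direct_sum_module {0..D} (\<lambda>p. direct_sum_module {0..p div 2} (\<lambda>k.
                 copies (multiplicity_L q D p k) (L p k)))))"
  using string_module_is_L[OF assms(1) _ _ refl] standard_module_isomorphic_L_sum[OF assms(1), unfolded L_sum_def]
  by blast

end
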